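(* Let $f$, $A_1,\dots,A_m\in\mathbb{S}^n$, $b\in\mathbb{R}^m$, $r\ge1$, $\gamma,\rho>0$ be as in the context, and assume (A1), (A2), (A3), (A4) stated there. Let the initial point $(U^0,V^0,\lambda^0)$ satisfy $$\mathcal{L}_\rho(U^0,V^0,\lambda^0)+\tfrac1\rho\|\lambda^0\|_2^2\le\beta^0<\hat\beta,$$ where $\beta^0,\hat\beta$ are constants independent of $\rho$, and let $\rho$ and $\gamma$ satisfy $$\rho>\max\left\{2\rho_0,\ \frac{2c_1}{\gamma},\ \frac{2c_2}{\gamma},\ \frac{1}{\hat\beta-\beta^0}\left(\frac{L_f^\delta\delta+2\gamma\delta}{\eta}\right)^2\right\},\qquad \gamma>\rho_0,$$ where $$c_1=\frac{2}{\eta^2}\left(L^\delta\delta^2+L_f^\delta+\gamma+\frac1\eta L_f^\delta\delta\sqrt{s_A}+\frac2\eta\gamma\delta\sqrt{s_A}\right)^2,\qquad c_2=\frac{2}{\eta^2}\left(L^\delta\delta^2+\gamma\right)^2.$$ Then the sequence $\{(U^k,V^k,\lambda^k)\}_{k\ge0}$ generated by the low-rank ADMM algorithm from this initial point converges to a KKT point $(\overline U,\overline V,\overline\lambda)$ of the penalized problem. Moreover, the total number of iterations needed to achieve an $\epsilon$-KKT point of the penalized problem is $\mathcal{O}(\epsilon^{-1})$; that is, there are constants $M,\epsilon_0>0$ such that for every $\epsilon\in(0,\epsilon_0]$ some iterate $(U^k,V^k,\lambda^k)$ with $k\le M/\epsilon$ is an $\epsilon$-KKT point.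
   Context: $\mathbb{S}^n$: real symmetric $n\times n$ matrices; $\langle X,Y\rangle=\operatorname{tr}(X^\top Y)$; $\|\cdot\|_F$ Frobenius norm, $\|\cdot\|_2$ Euclidean norm. $\mathcal{A}(X)=(\langle A_1,X\rangle,\dots,\langle A_m,X\rangle)^\top$ for $X\in\mathbb{R}^{n\times n}$; $s_A=\sum_{i=1}^m\|A_i\|_F^2$. $f:\mathbb{R}^{n\times n}\to\mathbb{R}$ is convex and twice differentiable. Penalized problem: $\min_{U,V\in\mathbb{R}^{n\times r}}f(UV^\top)+\frac\gamma2\|U-V\|_F^2$ s.t. $\mathcal{A}(UV^\top)=b$. A triple $(U,V,\lambda)\in\mathbb{R}^{n\times r}\times\mathbb{R}^{n\times r}\times\mathbb{R}^m$ is an $\epsilon$-KKT point of it if $\|\nabla f(UV^\top)V+\gamma(U-V)+\sum_i\lambda_iA_iV\|_F\le\epsilon$, $\|\nabla f(VU^\top)U+\gamma(V-U)+\sum_i\lambda_iA_iU\|_F\le\epsilon$ and $\|\mathcal{A}(UV^\top)-b\|_2\le\epsilon$; a KKT point is a $0$-KKT point. $\mathcal{W}$ is the set of KKT points. Augmented Lagrangian: $\mathcal{L}_\rho(U,V,\lambda)=f(UV^\top)+\frac\gamma2\|U-V\|_F^2+\langle\lambda,\mathcal{A}(UV^\top)-b\rangle+\frac\rho2\|\mathcal{A}(UV^\top)-b\|_2^2$. Low-rank ADMM: for $k=0,1,\dots$, $U^{k+1}=\operatorname{argmin}_U\mathcal{L}_\rho(U,V^k,\lambda^k)$, $V^{k+1}=\operatorname{argmin}_V\mathcal{L}_\rho(U^{k+1},V,\lambda^k)$,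 $\lambda^{k+1}=\lambda^k+\rho(\mathcal{A}(U^{k+1}(V^{k+1})^\top)-b)$. Assumptions: (A1) $\mathcal{W}$ is nonempty; $f(X)=f(X^\top)$ for all $X\in\mathbb{R}^{n\times n}$; $\nabla f$ and $\nabla^2f$ are Lipschitz continuous on any convex compact set. (A2) There is $\rho_0>0$ such that for any $\beta$ the level set $S_\beta=\{(U,V): f(UV^\top)+\frac{\rho_0}{2}\|U-V\|_F^2+\frac{\rho_0}{2}\|\mathcal{A}(UV^\top)-b\|_2^2\le\beta\}$ is either compact or empty. (This $\rho_0$ is fixed.) By (A2), $S_{\hat\beta}$ is bounded, and $\delta>0$ denotes a constant with $\|U\|_F\le\delta$ and $\|V\|_F\le\delta$ for all $(U,V)\in S_{\hat\beta}$. (A3) There is a constant $\eta>0$ with $\min_{(U,V)\in S_{\hat\beta}}\sigma_{\min}(\mathcal{C}(U))\ge\eta$, where $\mathcal{C}(U)=[\operatorname{vec}(A_1U),\dots,\operatorname{vec}(A_mU)]\in\mathbb{R}^{nr\times m}$ and $\sigma_{\min}(\mathcal C(U))=\min_{\|x\|_2=1}\|\mathcal{C}(U)x\|_2$ (so the columns are linearly independent). (A4) (Łojasiewicz inequality) $\mathcal{L}_\rho$ satisfies the Łojasiewicz inequality with exponent $\alpha\in[0,1)$ at any KKT point: there exist constants $c,\delta_c>0$ such that for any $(U,V,\lambda)\in\mathbb{R}^{n\times r}\times\mathbb{R}^{n\times r}\times\mathbb{R}^m$ and $(\overline U,\overline V,\overline\lambda)\in\mathcal{W}$ with $\operatorname{dist}((U,V,\lambda),(\overline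 U,\overline V,\overline\lambda))\le\delta_c$, $$|\mathcal{L}_\rho(U,V,\lambda)-\mathcal{L}_\rho(\overline U,\overline V,\overline\lambda)|^\alpha\le c\,\|\nabla\mathcal{L}_\rho(U,V,\lambda)\|_F.$$ Here $\nabla$ is the gradient in all of $(U,V,\lambda)$, norms and distances on triples are Euclidean, and $0^0=0$ by convention. Constants: $L_f^\delta$ and $L^\delta$ are such that $\|\nabla f(X)\|_F\le L_f^\delta$ and $\nabla f$ is $L^\delta$-Lipschitz (Frobenius norm) on the ball $\{X\in\mathbb{R}^{n\times n}:\|X\|_F\le\delta^2\}$. *)

theory Defs
  imports "HOL-Analysis.Analysis"
begin

text \<open>
  An \<open>n \<times> r\<close> real matrix has type \<^typ>\<open>real^'r^'n\<close>. The library norm on this type is the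
  Frobenius norm and its inner product is the trace inner product; on nested pairs
  \<open>(U, V, \<lambda>)\<close> the norm, distance and inner product are the Euclidean ones.
\<close>

lemma inner_eq_trace:
  fixes X Y :: "real^'r^'n"
  shows "X \<bullet> Y = trace (transpose X ** Y)"
  unfolding inner_vec_def trace_def matrix_matrix_mult_def transpose_def
  by (simp add: sum.swap[of _ "UNIV :: 'r set"])

definition gradient :: "('a::real_inner \<Rightarrow> real) \<Rightarrow> 'a \<Rightarrow> 'a" where
  "gradient g x = (THE D. GDERIV g x :> D)"

definition hessian :: "('a::real_inner \<Rightarrow> real) \<Rightarrow> 'a \<Rightarrow> 'a \<Rightarrow>\<^sub>L 'a" where
  "hessian g x = Blinfun (frechet_derivative (gradient g) (at x))"

definition twice_differentiable :: "('a::real_inner \<Rightarrow> real) \<Rightarrow> bool" where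
  "twice_differentiable g \<longleftrightarrow>
     (\<forall>x. g differentiable (at x)) \<and> (\<forall>x. gradient g differentiable (at x))"

definition lin_op :: "('m \<Rightarrow> real^'n^'n) \<Rightarrow> real^'n^'n \<Rightarrow> real^'m" where
  "lin_op A X = (\<chi> i. A i \<bullet> X)"

definition eps_kkt ::
  "(real^'n^'n \<Rightarrow> real) \<Rightarrow> ('m::finite \<Rightarrow> real^'n^'n) \<Rightarrow> real^'m \<Rightarrow> real \<Rightarrow> real
     \<Rightarrow> (real^'r^'n) \<times> (real^'r^'n) \<times> (real^'m) \<Rightarrow> bool" where
  "eps_kkt f A b \<gamma> \<epsilon> = (\<lambda>(U, V, l).
     norm (gradient f (U ** transpose V) ** V + \<gamma> *\<^sub>R (U - V)
           + (\<Sum>i\<in>UNIV. (l $ i) *\<^sub>R (A i ** V))) \<le> \<epsilon> \<and>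
     norm (gradient f (V ** transpose U) ** U + \<gamma> *\<^sub>R (V - U)
           + (\<Sum>i\<in>UNIV. (l $ i) *\<^sub>R (A i ** U))) \<le> \<epsilon> \<and>
     norm (lin_op A (U ** transpose V) - b) \<le> \<epsilon>)"

definition kkt_points ::
  "(real^'n^'n \<Rightarrow> real) \<Rightarrow> ('m::finite \<Rightarrow> real^'n^'n) \<Rightarrow> real^'m \<Rightarrow> real
     \<Rightarrow> ((real^'r^'n) \<times> (real^'r^'n) \<times> (real^'m)) set" where
  "kkt_points f A b \<gamma> = {Z. eps_kkt f A b \<gamma> 0 Z}"

definition aug_lagrangian ::
  "(real^'n^'n \<Rightarrow> real) \<Rightarrow> ('m::finite \<Rightarrow> real^'n^'n) \<Rightarrow> real^'m \<Rightarrow> real \<Rightarrow> real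
     \<Rightarrow> (real^'r^'n) \<times> (real^'r^'n) \<times> (real^'m) \<Rightarrow> real" where
  "aug_lagrangian f A b \<gamma> \<rho> = (\<lambda>(U, V, l).
     f (U ** transpose V) + \<gamma> / 2 * (norm (U - V))\<^sup>2
       + l \<bullet> (lin_op A (U ** transpose V) - b)
       + \<rho> / 2 * (norm (lin_op A (U ** transpose V) - b))\<^sup>2)"

definition admm ::
  "(real^'n^'n \<Rightarrow> real) \<Rightarrow> ('m::finite \<Rightarrow> real^'n^'n) \<Rightarrow> real^'m \<Rightarrow> real \<Rightarrow> real
     \<Rightarrow> (nat \<Rightarrow> real^'r^'n) \<Rightarrow> (nat \<Rightarrow> real^'r^'n) \<Rightarrow> (nat \<Rightarrow> real^'m) \<Rightarrow> bool" where
  "admm f A b \<gamma> \<rho> U V l \<longleftrightarrow> (\<forall>k.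
     is_arg_min (\<lambda>W. aug_lagrangian f A b \<gamma> \<rho> (W, V k, l k)) (\<lambda>_. True) (U (Suc k)) \<and>
     is_arg_min (\<lambda>W. aug_lagrangian f A b \<gamma> \<rho> (U (Suc k), W, l k)) (\<lambda>_. True) (V (Suc k)) \<and>
     l (Suc k) = l k + \<rho> *\<^sub>R (lin_op A (U (Suc k) ** transpose (V (Suc k))) - b))"

definition level_set ::
  "(real^'n^'n \<Rightarrow> real) \<Rightarrow> ('m::finite \<Rightarrow> real^'n^'n) \<Rightarrow> real^'m \<Rightarrow> real \<Rightarrow> real
     \<Rightarrow> ((real^'r^'n) \<times> (real^'r^'n)) set" where
  "level_set f A b \<rho>\<^sub>0 \<beta> = {(U, V).
     f (U ** transpose V) + \<rho>\<^sub>0 / 2 * (norm (U - V))\<^sup>2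
       + \<rho>\<^sub>0 / 2 * (norm (lin_op A (U ** transpose V) - b))\<^sup>2 \<le> \<beta>}"

text \<open>Column-stacking: the index \<open>(j, i)\<close> addresses row \<open>i\<close> of column \<open>j\<close>.\<close>

definition vec_mat :: "real^'r^'n \<Rightarrow> real^('r \<times> 'n)" where
  "vec_mat X = (\<chi> p. X $ snd p $ fst p)"

definition constr_mat :: "('m \<Rightarrow> real^'n^'n) \<Rightarrow> real^'r^'n \<Rightarrow> real^'m^('r \<times> 'n)" where
  "constr_mat A U = (\<chi> p i. vec_mat (A i ** U) $ p)"

text \<open>The infimum is attained, since the unit sphere is compact and nonempty.\<close>

definition sigma_min :: "real^'m^'k \<Rightarrow> real" where
  "sigma_min M = (INF x\<in>sphere 0 1. norm (M *v x))"

text \<open>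
  The inequality uses \<open>powr\<close>, for which \<^prop>\<open>0 powr 0 = (0::real)\<close>, as the convention
  for exponent \<open>0\<close> requires.
\<close>

definition lojasiewicz_on :: "('a::real_inner \<Rightarrow> real) \<Rightarrow> 'a set \<Rightarrow> real \<Rightarrow> bool" where
  "lojasiewicz_on g W \<alpha> \<longleftrightarrow>
     (\<exists>c>0. \<exists>d>0. \<forall>Z. \<forall>Z'\<in>W. dist Z Z' \<le> d \<longrightarrow>
        \<bar>g Z - g Z'\<bar> powr \<alpha> \<le> c * norm (gradient g Z))"

definition const_c1 :: "real \<Rightarrow> real \<Rightarrow> real \<Rightarrow> real \<Rightarrow> real \<Rightarrow> real \<Rightarrow> real" where
  "const_c1 \<eta> \<delta> L Lf \<gamma> s =
     2 / \<eta>\<^sup>2 * (L * \<delta>\<^sup>2 + Lf + \<gamma> + 1 / \<eta> * Lf * \<delta> * sqrt s + 2 / \<eta> * \<gamma> * \<delta> * sqrt s)\<^sup>2"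

definition const_c2 :: "real \<Rightarrow> real \<Rightarrow> real \<Rightarrow> real \<Rightarrow> real" where
  "const_c2 \<eta> \<delta> L \<gamma> = 2 / \<eta>\<^sup>2 * (L * \<delta>\<^sup>2 + \<gamma>)\<^sup>2"

end

theory Submission
  imports Defs
begin

text \<open>
  For fixed \<open>U\<close> the objective \<open>f (U V\<^sup>T) + \<gamma>/2 \<parallel>U - V\<parallel>\<^sup>2\<close> is \<open>\<gamma>\<close>-strongly convex in \<open>V\<close>, and
  vice versa. Each block minimization therefore decreases the augmented Lagrangian by \<open>\<gamma>/2\<close> times the
  squared step. The dual step increases it by \<open>\<parallel>\<Delta>\<lambda>\<parallel>\<^sup>2/\<rho>\<close>. The minimization in \<open>V\<close> makes the new dual
  variable a multiplier of the new pair, and multipliers are Lipschitz functions of the pair as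
  long as the factors are bounded and the constraint gradients are uniformly independent
  (\<open>multiplier_lipschitz\<close>). For large \<open>\<rho>\<close> the increase is thus dominated by the decrease
  (\<open>multiplier_step_le\<close>). From here on the argument is the standard one: descent, a gradient bound by
  the last step, and the Lojasiewicz inequality give a path of finite length, hence convergence
  (\<open>lojasiewicz_convergence\<close>); the shortest of the first \<open>n\<close> steps is \<open>O(1/n)\<close>, which is the complexity
  bound.

  The delicate part is to show that the iterates never leave the region in which these estimates hold.
  The initial dual variable \<open>\<lambda>\<^sup>0\<close> is arbitrary, so the first dual step is not paid for by descent and the
  augmented Lagrangian may rise in it. The argument does not place the pairs \<open>(U\<^sup>k, V\<^sup>k)\<close> in the level
  set at \<open>\<beta>hat\<close>. The estimates concern the single factors only, so it is enough that each
  factor has \<^emph>\<open>some\<close> partner with which it lies in the level set. Such a partner is obtained by minimizing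
  the merit function \<open>T\<close> in the other block. With the level \<open>\<kappa> = \<beta>\<^sub>0 + \<Lambda>\<^sup>2/\<rho> < \<beta>hat\<close>, where \<open>\<Lambda>\<close>
  bounds all multipliers, a new \<open>U\<close> has a partner at level \<open>\<kappa>\<close> as long as the augmented Lagrangian is at
  most \<open>\<kappa>\<close> (\<open>T_after_U_step\<close>), and a new \<open>V\<close> as long as a second potential is
  (\<open>T_after_V_step\<close>). This potential, \<open>energy\<close>, compares the multipliers of the two block
  minimizations; it decreases from one iteration to the next by at least a sum of squares
  (\<open>energy_decreasing\<close>), and it starts at most at \<open>\<kappa>\<close> since a large \<open>\<lambda>\<^sup>0\<close> lowers the
  objective of the first iterate by enough to pay for the first dual step (\<open>first_D_le\<close>).

  The bounds behind these statements presuppose that the new factor is already in the region. This is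
  resolved by continuity: a point moving from the old to the new factor stays at level \<open>\<kappa>\<close> while it is
  in the region, and it cannot jump over the gap between \<open>\<kappa>\<close> and \<open>\<beta>hat\<close>
  (\<open>minimum_continuation\<close>, \<open>second_U_level\<close>).
\<close>

section \<open>Matrices with the Frobenius inner product\<close>

lemma power2_norm_vec: "(norm x)\<^sup>2 = (\<Sum>i\<in>UNIV. (norm (x $ i))\<^sup>2)"
  for x :: "'a::real_inner^'n"
  by (simp add: power2_norm_eq_inner inner_vec_def)

lemma inner_transpose: "transpose X \<bullet> transpose Y = X \<bullet> Y"
  for X Y :: "real^'r^'n"
  unfolding inner_vec_def transpose_def by (simp add: sum.swap[of _ "UNIV :: 'r set"])

lemma norm_transpose: "norm (transpose X) = norm X"
  for X :: "real^'r^'n"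
  by (simp add: norm_eq_sqrt_inner inner_transpose)

lemma norm_matrix_mult_le: "norm (X ** Y) \<le> norm X * norm Y"
  for X :: "real^'k^'n" and Y :: "real^'r^'k"
proof -
  have entry: "(X ** Y) $ i $ j = X $ i \<bullet> transpose Y $ j" for i j
    by (simp add: matrix_matrix_mult_def transpose_def inner_vec_def)
  have "(norm (X ** Y))\<^sup>2 = (\<Sum>i\<in>UNIV. \<Sum>j\<in>UNIV. (X $ i \<bullet> transpose Y $ j)\<^sup>2)"
    by (simp add: power2_norm_vec entry)
  also have "\<dots> \<le> (\<Sum>i\<in>UNIV. \<Sum>j\<in>UNIV. (norm (X $ i))\<^sup>2 * (norm (transpose Y $ j))\<^sup>2)"
    by (intro sum_mono) (simp add: Cauchy_Schwarz_ineq power2_norm_eq_inner)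
  also have "\<dots> = (norm X)\<^sup>2 * (norm (transpose Y))\<^sup>2"
    by (simp add: power2_norm_vec sum_product)
  finally show ?thesis
    by (simp add: norm_transpose flip: power_mult_distrib)
qed

lemma transpose_add: "transpose (X + Y) = transpose X + transpose Y"
  for X Y :: "real^'r^'n"
  by (simp add: transpose_def vec_eq_iff)

lemma transpose_diff: "transpose (X - Y) = transpose X - transpose Y"
  for X Y :: "real^'r^'n"
  by (simp add: transpose_def vec_eq_iff)

lemma transpose_scaleR: "transpose (c *\<^sub>R X) = c *\<^sub>R transpose X"
  for X :: "real^'r^'n"
  by (simp add: transpose_def vec_eq_iff)

lemma bounded_linear_transpose: "bounded_linear (transpose :: real^'r^'n \<Rightarrow> real^'n^'r)"
  by (rule bounded_linear_intro[where K = 1])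
    (simp_all add: transpose_add transpose_scaleR norm_transpose)

lemma bounded_bilinear_matrix_mult:
  "bounded_bilinear ((**) :: real^'k^'n \<Rightarrow> real^'r^'k \<Rightarrow> real^'r^'n)"
proof
  show "\<exists>K. \<forall>a b. norm (a ** b :: real^'r^'n) \<le> norm (a :: real^'k^'n) * norm b * K"
    by (intro exI[of _ 1]) (simp add: norm_matrix_mult_le)
qed (simp_all add: matrix_matrix_mult_def vec_eq_iff sum_distrib_left algebra_simps sum.distrib)

lemmas matrix_mult_diff_left = bounded_bilinear.diff_left[OF bounded_bilinear_matrix_mult]
lemmas matrix_mult_diff_right = bounded_bilinear.diff_right[OF bounded_bilinear_matrix_mult]
lemmas matrix_mult_add_left = bounded_bilinear.add_left[OF bounded_bilinear_matrix_mult]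
lemmas matrix_mult_scaleR_left = bounded_bilinear.scaleR_left[OF bounded_bilinear_matrix_mult]
lemmas matrix_mult_sum_left = bounded_bilinear.sum_left[OF bounded_bilinear_matrix_mult]

lemmas continuous_on_matrix_mult [continuous_intros] =
  bounded_bilinear.continuous_on[OF bounded_bilinear_matrix_mult]
lemmas continuous_on_transpose [continuous_intros] =
  bounded_linear.continuous_on[OF bounded_linear_transpose]
lemmas has_derivative_matrix_mult [derivative_intros] =
  bounded_bilinear.FDERIV[OF bounded_bilinear_matrix_mult]
lemmas has_derivative_transpose [derivative_intros] =
  bounded_linear.has_derivative[OF bounded_linear_transpose]

lemma transpose_mult_transpose: "transpose (X ** transpose Y) = Y ** transpose X"
  for X Y :: "real^'r^'n"
  by (simp add: matrix_transpose_mul)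

lemma inner_outer_left: "G \<bullet> (X ** transpose Y) = (G ** Y) \<bullet> X"
  for G :: "real^'n^'n" and X Y :: "real^'r^'n"
  unfolding inner_vec_def matrix_matrix_mult_def transpose_def
  apply (simp add: sum_distrib_left sum_distrib_right)
  apply (rule sum.cong[OF refl])
  apply (subst sum.swap)
  apply (intro sum.cong refl)
  apply (simp add: mult_ac)
  done

lemma inner_outer_right: "G \<bullet> (X ** transpose Y) = (transpose G ** X) \<bullet> Y"
  for G :: "real^'n^'n" and X Y :: "real^'r^'n"
  by (metis inner_outer_left inner_transpose transpose_mult_transpose)

text \<open>
  The difference splits as \<open>(U - U') V\<^sup>T + U' (V - V')\<^sup>T\<close>, hence the asymmetric hypotheses.
\<close>

lemma norm_outer_diff_le:
  fixes U V U' V' :: "real^'r^'n"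
  assumes "norm V \<le> d" "norm U' \<le> d"
  shows "norm (U ** transpose V - U' ** transpose V') \<le> d * (norm (U - U') + norm (V - V'))"
proof -
  have "U ** transpose V - U' ** transpose V'
      = (U - U') ** transpose V + U' ** transpose (V - V')"
    by (simp add: matrix_mult_diff_left matrix_mult_diff_right transpose_diff)
  then have "norm (U ** transpose V - U' ** transpose V')
      \<le> norm (U - U') * norm V + norm U' * norm (V - V')"
    by (smt (verit) norm_matrix_mult_le norm_transpose norm_triangle_ineq)
  also have "\<dots> \<le> norm (U - U') * d + d * norm (V - V')"
    using assms by (intro add_mono mult_left_mono mult_right_mono) auto
  finally show ?thesis by (simp add: algebra_simps)
qed

section \<open>Gradients\<close>

lemma GDERIV_unique: "GDERIV g x :> D \<Longrightarrow> GDERIV g x :> D' \<Longrightarrow> D = D'"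
  unfolding gderiv_def
  by (metis (no_types, lifting) ext has_derivative_unique vector_eq_ldot)

lemma gradient_eq: "GDERIV g x :> D \<Longrightarrow> gradient g x = D"
  unfolding gradient_def by (blast intro: GDERIV_unique)

text \<open>
  On a Euclidean space every derivative is represented by a vector, so the definite description in
  the definition of the gradient is proper at points of differentiability.
\<close>

lemma GDERIV_gradient:
  fixes g :: "'a::euclidean_space \<Rightarrow> real"
  assumes "g differentiable (at x)"
  shows "GDERIV g x :> gradient g x"
proof -
  obtain g' where g': "(g has_derivative g') (at x)"
    using assms by (auto simp: differentiable_def)
  define D where "D = (\<Sum>b\<in>Basis. g' b *\<^sub>R b)"
  have lin: "linear g'" using g' by (rule has_derivative_linear)
  have "g' h = h \<bullet> D" for h
  proof -
    have "g' h = g' (\<Sum>b\<in>Basis. (h \<bullet> b) *\<^sub>R b)" by (simp add: euclidean_representation)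
    also have "\<dots> = (\<Sum>b\<in>Basis. (h \<bullet> b) *\<^sub>R g' b)"
      by (simp add: linear_sum[OF lin] linear_scale[OF lin])
    also have "\<dots> = h \<bullet> D" by (simp add: D_def inner_sum_right mult_ac)
    finally show ?thesis .
  qed
  then have "g' = (\<lambda>h. h \<bullet> D)" by blast
  then have "GDERIV g x :> D" using g' by (simp add: gderiv_def)
  then show ?thesis using gradient_eq by blast
qed

lemma GDERIV_zero_at_minimum:
  assumes "GDERIV g x :> D" "\<And>y. g x \<le> g y"
  shows "D = 0"
proof -
  have "(\<lambda>h. h \<bullet> D) = (\<lambda>h. 0)"
    using differential_zero_maxmin[of x UNIV g "\<lambda>h. h \<bullet> D"] assms by (simp add: gderiv_def)
  then show ?thesis by (metis inner_eq_zero_iff)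
qed

text \<open>
  The tangent inequality of convexity, reduced to the one-dimensional case on the line from \<open>x\<close>
  to \<open>y\<close>.
\<close>

lemma convex_on_gradient_le:
  assumes "convex_on UNIV g" "GDERIV g x :> D"
  shows "g x + D \<bullet> (y - x) \<le> g y"
proof -
  define h where "h = (\<lambda>t::real. g (x + t *\<^sub>R (y - x)))"
  have cvx: "convex_on UNIV h"
  proof (rule convex_onI)
    fix t a c :: real assume t: "0 < t" "t < 1"
    have "x + ((1 - t) *\<^sub>R a + t *\<^sub>R c) *\<^sub>R (y - x)
        = (1 - t) *\<^sub>R (x + a *\<^sub>R (y - x)) + t *\<^sub>R (x + c *\<^sub>R (y - x))"
      by (simp add: algebra_simps)
    then show "h ((1 - t) *\<^sub>R a + t *\<^sub>R c) \<le> (1 - t) * h a + t * h c"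
      unfolding h_def using convex_onD[OF assms(1), of t] t by simp
  qed simp
  have "(h has_derivative (\<lambda>t. (t *\<^sub>R (y - x)) \<bullet> D)) (at 0)"
    unfolding h_def
    by (rule has_derivative_compose[where g = g, of "\<lambda>t. x + t *\<^sub>R (y - x)" "\<lambda>t. t *\<^sub>R (y - x)"])
      (use assms(2) in \<open>auto intro!: derivative_eq_intros simp: gderiv_def\<close>)
  then have "(h has_field_derivative (D \<bullet> (y - x))) (at 0)"
    by (simp add: has_field_derivative_def inner_commute mult_commute_abs)
  then have "h 1 - h 0 \<ge> (D \<bullet> (y - x)) * (1 - 0)"
    using convex_on_imp_above_tangent[OF cvx, of 0 1] by simp
  then show ?thesis by (simp add: h_def)
qed

text \<open>
  Young's inequality: expand \<open>0 \<le> \<parallel>x - c r\<parallel>\<^sup>2\<close>.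
\<close>

lemma inner_le_young:
  fixes x r :: "'a::real_inner"
  assumes "c > 0"
  shows "x \<bullet> r \<le> (norm x)\<^sup>2 / (2 * c) + c / 2 * (norm r)\<^sup>2"
proof -
  have "0 \<le> (norm (x - c *\<^sub>R r))\<^sup>2 / (2 * c)" using assms by simp
  also have "\<dots> = (norm x)\<^sup>2 / (2 * c) + c / 2 * (norm r)\<^sup>2 - x \<bullet> r"
    using assms
    by (simp add: power2_norm_eq_inner inner_diff_left inner_diff_right inner_commute[of r x]
        field_simps)
  finally show ?thesis by simp
qed

section \<open>The penalized problem and its multipliers\<close>

locale penalized_problem =
  fixes f :: "real^'n^'n \<Rightarrow> real"
    and A :: "'m::finite \<Rightarrow> real^'n^'n"
    and b :: "real^'m"
    and \<gamma> \<rho> :: real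
  assumes convex_f: "convex_on UNIV f"
    and differentiable_f: "\<And>X. f differentiable (at X)"
    and continuous_gradient: "continuous_on UNIV (gradient f)"
    and symmetric_f: "\<And>X. f (transpose X) = f X"
    and symmetric_A: "\<And>i. transpose (A i) = A i"
    and gamma_pos: "\<gamma> > 0"
    and rho_pos: "\<rho> > 0"
begin

text \<open>
  The objective of the penalized problem. It is symmetric in its two arguments, as is the residual
  below, so every statement about one block has a mirror image about the other.
\<close>

definition D :: "real^'r^'n \<Rightarrow> real^'r^'n \<Rightarrow> real" where
  "D U V = f (U ** transpose V) + \<gamma> / 2 * (norm (U - V))\<^sup>2"

definition res :: "real^'r^'n \<Rightarrow> real^'r^'n \<Rightarrow> real^'m" where
  "res U V = lin_op A (U ** transpose V) - b"

definition adj :: "real^'m \<Rightarrow> real^'n^'n" where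
  "adj y = (\<Sum>i\<in>UNIV. y $ i *\<^sub>R A i)"

text \<open>
  Stationarity in \<open>V\<close>, for fixed \<open>U\<close>, of the ordinary Lagrangian with multiplier \<open>y\<close>. By symmetry
  \<open>multiplier V U y\<close> is stationarity in \<open>U\<close>. An exact block minimization always produces such
  a \<open>y\<close>: the old dual variable shifted by a multiple of the new residual.
\<close>

definition multiplier :: "real^'r^'n \<Rightarrow> real^'r^'n \<Rightarrow> real^'m \<Rightarrow> bool" where
  "multiplier U V y \<longleftrightarrow> gradient f (V ** transpose U) ** U + \<gamma> *\<^sub>R (V - U) + adj y ** U = 0"

definition AL :: "real^'r^'n \<Rightarrow> real^'r^'n \<Rightarrow> real^'m \<Rightarrow> real" where
  "AL U V l = D U V + l \<bullet> res U V + \<rho> / 2 * (norm (res U V))\<^sup>2"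

text \<open>
  A merit function without dual variable. The weight \<open>\<rho>/4\<close> is what remains of \<open>\<rho>/2\<close> when the dual
  term of the augmented Lagrangian is absorbed by Young's inequality at the price \<open>\<parallel>l\<parallel>\<^sup>2/\<rho>\<close>; it still
  dominates the function whose level sets are assumed compact.
\<close>

definition T :: "real^'r^'n \<Rightarrow> real^'r^'n \<Rightarrow> real" where
  "T U V = D U V + \<rho> / 4 * (norm (res U V))\<^sup>2"

lemma aug_lagrangian_eq_AL: "aug_lagrangian f A b \<gamma> \<rho> (U, V, l) = AL U V l"
  by (simp add: aug_lagrangian_def AL_def D_def res_def)

lemma GDERIV_f: "GDERIV f X :> gradient f X"
  by (rule GDERIV_gradient[OF differentiable_f])

text \<open>
  Differentiate the identity \<open>f (X\<^sup>T) = f X\<close>.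
\<close>

lemma gradient_transpose: "gradient f (transpose X) = transpose (gradient f X)"
proof -
  have "(f has_derivative (\<lambda>h. h \<bullet> gradient f (transpose X))) (at (transpose X))"
    using GDERIV_f by (simp add: gderiv_def)
  then have "((\<lambda>X. f (transpose X)) has_derivative (\<lambda>h. transpose h \<bullet> gradient f (transpose X))) (at X)"
    by (rule has_derivative_compose[rotated]) (auto intro!: derivative_eq_intros)
  then have "GDERIV f X :> transpose (gradient f (transpose X))"
    unfolding gderiv_def symmetric_f
    by (metis (no_types, lifting) ext inner_transpose transpose_transpose)
  then show ?thesis
    by (metis gradient_eq transpose_transpose)
qed

lemma gradient_outer_swap: "gradient f (V ** transpose U) = transpose (gradient f (U ** transpose V))"
  for U V :: "real^'r^'n"
  by (metis gradient_transpose transpose_mult_transpose)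

lemma inner_lin_op: "y \<bullet> lin_op A X = adj y \<bullet> X"
  by (simp add: inner_vec_def[of y] lin_op_def adj_def inner_sum_left)

lemma lin_op_transpose: "lin_op A (transpose X) = lin_op A X"
  by (simp add: lin_op_def vec_eq_iff) (metis inner_transpose symmetric_A)

lemma lin_op_diff: "lin_op A (X - Y) = lin_op A X - lin_op A Y"
  by (simp add: lin_op_def vec_eq_iff inner_diff_right)

lemma bounded_linear_lin_op: "bounded_linear (lin_op A)"
  by (intro linear_conv_bounded_linear[THEN iffD1] linearI)
    (simp_all add: lin_op_def vec_eq_iff inner_add_right)

lemma transpose_adj: "transpose (adj y) = adj y"
  unfolding adj_def
  by (simp add: linear_sum[OF bounded_linear.linear[OF bounded_linear_transpose]]
      transpose_scaleR symmetric_A)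

lemma adj_diff: "adj (x - y) = adj x - adj y"
  by (simp add: adj_def scaleR_diff_left sum_subtractf)

lemma adj_add: "adj (x + y) = adj x + adj y"
  by (simp add: adj_def scaleR_add_left sum.distrib)

lemma adj_mult: "adj y ** U = (\<Sum>i\<in>UNIV. y $ i *\<^sub>R (A i ** U))"
  by (simp add: adj_def matrix_mult_sum_left matrix_mult_scaleR_left)

lemma norm_adj_le: "norm (adj y) \<le> sqrt (\<Sum>i\<in>UNIV. (norm (A i))\<^sup>2) * norm y"
proof -
  have "norm (adj y) \<le> (\<Sum>i\<in>UNIV. \<bar>y $ i\<bar> * norm (A i))"
    unfolding adj_def by (rule order_trans[OF norm_sum]) simp
  also have "\<dots> = (\<Sum>i\<in>UNIV. \<bar>y $ i\<bar> * \<bar>norm (A i)\<bar>)" by simp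
  also have "\<dots> \<le> L2_set (($) y) UNIV * L2_set (\<lambda>i. norm (A i)) UNIV"
    by (rule L2_set_mult_ineq)
  finally show ?thesis by (simp add: norm_vec_def L2_set_def mult.commute)
qed

lemma norm_lin_op_le: "norm (lin_op A X) \<le> sqrt (\<Sum>i\<in>UNIV. (norm (A i))\<^sup>2) * norm X"
proof (cases "lin_op A X = 0")
  case False
  have "norm (lin_op A X) * norm (lin_op A X) = adj (lin_op A X) \<bullet> X"
    by (simp add: inner_lin_op[symmetric] power2_norm_eq_inner flip: power2_eq_square)
  also have "\<dots> \<le> norm (adj (lin_op A X)) * norm X" by (rule norm_cauchy_schwarz)
  also have "\<dots> \<le> sqrt (\<Sum>i\<in>UNIV. (norm (A i))\<^sup>2) * norm (lin_op A X) * norm X"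
    by (intro mult_right_mono norm_adj_le) simp
  finally show ?thesis using False by (simp add: mult_ac)
qed (simp add: sum_nonneg)

lemma D_commute: "D U V = D V U"
  by (metis D_def norm_minus_commute symmetric_f transpose_mult_transpose)

lemma res_commute: "res U V = res V U"
  by (metis res_def lin_op_transpose transpose_mult_transpose)

lemma T_commute: "T U V = T V U"
  by (simp add: T_def D_commute[of U] res_commute[of U])

lemma AL_commute: "AL U V l = AL V U l"
  by (simp add: AL_def D_commute[of U] res_commute[of U])

lemma continuous_f: "continuous_on UNIV f"
  by (simp add: continuous_on_eq_continuous_within differentiable_f
      differentiable_imp_continuous_within)

lemma continuous_on_f [continuous_intros]:
  "continuous_on S g \<Longrightarrow> continuous_on S (\<lambda>x. f (g x))"
  by (rule continuous_on_compose2[OF continuous_f]) auto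

lemma continuous_on_gradient [continuous_intros]:
  "continuous_on S g \<Longrightarrow> continuous_on S (\<lambda>x. gradient f (g x))"
  by (rule continuous_on_compose2[OF continuous_gradient]) auto

lemma continuous_on_lin_op [continuous_intros]:
  "continuous_on S g \<Longrightarrow> continuous_on S (\<lambda>x. lin_op A (g x))"
  by (rule bounded_linear.continuous_on[OF bounded_linear_lin_op])

lemma continuous_on_D [continuous_intros]:
  "continuous_on S g \<Longrightarrow> continuous_on S h \<Longrightarrow> continuous_on S (\<lambda>x. D (g x) (h x))"
  unfolding D_def by (intro continuous_intros)

lemma continuous_on_res [continuous_intros]:
  "continuous_on S g \<Longrightarrow> continuous_on S h \<Longrightarrow> continuous_on S (\<lambda>x. res (g x) (h x))"
  unfolding res_def by (intro continuous_intros)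

lemma continuous_on_T [continuous_intros]:
  "continuous_on S g \<Longrightarrow> continuous_on S h \<Longrightarrow> continuous_on S (\<lambda>x. T (g x) (h x))"
  unfolding T_def by (intro continuous_intros)

lemma res_diff_right: "y \<bullet> res U W - y \<bullet> res U V = (adj y ** U) \<bullet> (W - V)"
  by (simp add: res_def inner_diff_right inner_lin_op inner_outer_right transpose_adj)

text \<open>
  For fixed \<open>U\<close> the objective is a convex function of \<open>V\<close> plus the quadratic \<open>\<gamma>/2 \<parallel>U - V\<parallel>\<^sup>2\<close>,
  hence \<open>\<gamma>\<close>-strongly convex.
\<close>

lemma D_gradient_le:
  "D U V + (gradient f (V ** transpose U) ** U + \<gamma> *\<^sub>R (V - U)) \<bullet> (W - V)
     + \<gamma> / 2 * (norm (W - V))\<^sup>2 \<le> D U W"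
proof -
  have "f (U ** transpose V) + gradient f (U ** transpose V) \<bullet> (U ** transpose W - U ** transpose V)
      \<le> f (U ** transpose W)"
    by (rule convex_on_gradient_le[OF convex_f GDERIV_f])
  moreover have "gradient f (U ** transpose V) \<bullet> (U ** transpose W - U ** transpose V)
      = (gradient f (V ** transpose U) ** U) \<bullet> (W - V)"
    by (simp add: inner_diff_right inner_outer_right gradient_outer_swap[of V U])
  moreover have "\<gamma> / 2 * (norm (U - W))\<^sup>2
      = \<gamma> / 2 * (norm (U - V))\<^sup>2 + (\<gamma> *\<^sub>R (V - U)) \<bullet> (W - V) + \<gamma> / 2 * (norm (W - V))\<^sup>2"
    by (simp add: power2_norm_eq_inner inner_diff_left inner_diff_right inner_commute algebra_simps)
  ultimately show ?thesis unfolding D_def inner_add_left by linarith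
qed

lemma adj_mult_multiplier:
  assumes "multiplier U V y"
  shows "adj y ** U = - (gradient f (V ** transpose U) ** U + \<gamma> *\<^sub>R (V - U))"
  using assms by (simp only: multiplier_def add_eq_0_iff)

text \<open>
  The workhorse: a multiplier turns strong convexity into a bound on the objective in terms of
  residuals only, because the gradient of the objective is \<open>- adj y U\<close>.
\<close>

lemma multiplier_growth:
  assumes "multiplier U V y"
  shows "D U V + \<gamma> / 2 * (norm (W - V))\<^sup>2 \<le> D U W + y \<bullet> (res U W - res U V)"
proof -
  have "gradient f (V ** transpose U) ** U + \<gamma> *\<^sub>R (V - U) = - (adj y ** U)"
    using adj_mult_multiplier[OF assms] by simp
  then show ?thesis
    using D_gradient_le[of U V W] res_diff_right[of y U W V] by (simp add: inner_diff_right)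
qed

text \<open>
  Completing the square. Since \<open>l + \<rho> res U V\<close> is the next multiplier, the augmented Lagrangian
  compares squared norms of consecutive multipliers.
\<close>

lemma AL_eq: "AL U V l = D U V + ((norm (l + \<rho> *\<^sub>R res U V))\<^sup>2 - (norm l)\<^sup>2) / (2 * \<rho>)"
  using rho_pos
  by (simp add: AL_def power2_norm_eq_inner inner_add_left inner_add_right inner_commute
      field_simps)

lemma T_le_AL: "T U V \<le> AL U V l + (norm l)\<^sup>2 / \<rho>"
proof -
  have "- (l \<bullet> res U V) \<le> (norm l)\<^sup>2 / \<rho> + \<rho> / 4 * (norm (res U V))\<^sup>2"
    using inner_le_young[of "\<rho> / 2" "- l" "res U V"] rho_pos by simp
  then show ?thesis unfolding AL_def T_def by linarith
qed

lemma AL_gradient_le: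
  "AL U V l + (gradient f (V ** transpose U) ** U + \<gamma> *\<^sub>R (V - U) + adj (l + \<rho> *\<^sub>R res U V) ** U) \<bullet> (W - V)
     + \<gamma> / 2 * (norm (W - V))\<^sup>2 \<le> AL U W l"
proof -
  have "0 \<le> \<rho> / 2 * (norm (res U W - res U V))\<^sup>2" using rho_pos by simp
  also have "\<dots> = l \<bullet> res U W + \<rho> / 2 * (norm (res U W))\<^sup>2 - (l \<bullet> res U V + \<rho> / 2 * (norm (res U V))\<^sup>2)
      - ((l + \<rho> *\<^sub>R res U V) \<bullet> res U W - (l + \<rho> *\<^sub>R res U V) \<bullet> res U V)"
    by (simp add: power2_norm_eq_inner inner_diff_left inner_diff_right inner_add_left
        inner_commute algebra_simps)
  also have "(l + \<rho> *\<^sub>R res U V) \<bullet> res U W - (l + \<rho> *\<^sub>R res U V) \<bullet> res U V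
      = (adj (l + \<rho> *\<^sub>R res U V) ** U) \<bullet> (W - V)"
    by (rule res_diff_right)
  finally show ?thesis
    using D_gradient_le[of U V W] unfolding AL_def inner_add_left by linarith
qed

text \<open>
  Not only the minimizer \<open>V\<close> but every point of the segment from \<open>W\<close> to \<open>V\<close> decreases the augmented
  Lagrangian by \<open>\<gamma>/2\<close> times its squared distance from \<open>W\<close>: along the segment the derivative points
  towards \<open>V\<close>, and strong convexity is applied at the intermediate point. This makes
  continuity arguments along the segment possible.
\<close>

lemma AL_growth_segment:
  assumes V: "multiplier U V (l + \<rho> *\<^sub>R res U V)" and s: "s \<in> {0..1}"
  shows "AL U (W + s *\<^sub>R (V - W)) l + \<gamma> / 2 * (norm (W + s *\<^sub>R (V - W) - W))\<^sup>2 \<le> AL U W l"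
proof -
  define grad where "grad = (\<lambda>V. gradient f (V ** transpose U) ** U + \<gamma> *\<^sub>R (V - U)
    + adj (l + \<rho> *\<^sub>R res U V) ** U)"
  have ge: "AL U X l + grad X \<bullet> (Y - X) + \<gamma> / 2 * (norm (Y - X))\<^sup>2 \<le> AL U Y l" for X Y
    unfolding grad_def by (rule AL_gradient_le)
  have grad_V: "grad V = 0" using V by (simp add: multiplier_def grad_def)
  let ?X = "W + s *\<^sub>R (V - W)"
  have "0 \<le> grad ?X \<bullet> (W - ?X)"
  proof (cases "s = 1")
    case False
    have "0 \<le> \<gamma> / 2 * (norm (?X - V))\<^sup>2" "0 \<le> \<gamma> / 2 * (norm (V - ?X))\<^sup>2"
      using gamma_pos by simp_all
    then have "grad ?X \<bullet> (V - ?X) \<le> 0"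
      using ge[of V ?X] ge[of ?X V] unfolding grad_V inner_zero_left by linarith
    moreover have "V - ?X = (1 - s) *\<^sub>R (V - W)" by (simp add: algebra_simps)
    ultimately have "grad ?X \<bullet> (V - W) \<le> 0"
      using False s by (simp add: mult_le_0_iff)
    moreover have "W - ?X = - (s *\<^sub>R (V - W))" by simp
    ultimately show ?thesis using s by (simp add: mult_le_0_iff)
  qed (simp add: grad_V)
  then show ?thesis using ge[of ?X W] by (simp add: norm_minus_commute)
qed

lemma has_derivative_D [derivative_intros]:
  assumes "(g has_derivative g') (at x)" "(h has_derivative h') (at x)"
  shows "((\<lambda>x. D (g x) (h x)) has_derivative (\<lambda>d.
    g' d \<bullet> (gradient f (g x ** transpose (h x)) ** h x + \<gamma> *\<^sub>R (g x - h x))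
    + h' d \<bullet> (gradient f (h x ** transpose (g x)) ** g x + \<gamma> *\<^sub>R (h x - g x)))) (at x)"
proof -
  have "((\<lambda>x. g x ** transpose (h x)) has_derivative
      (\<lambda>d. g x ** transpose (h' d) + g' d ** transpose (h x))) (at x)"
    by (rule has_derivative_matrix_mult[OF assms(1) has_derivative_transpose[OF assms(2)]])
  then have "((\<lambda>x. f (g x ** transpose (h x))) has_derivative
      (\<lambda>d. (g x ** transpose (h' d) + g' d ** transpose (h x)) \<bullet> gradient f (g x ** transpose (h x)))) (at x)"
    by (rule has_derivative_compose) (use GDERIV_f in \<open>simp add: gderiv_def\<close>)
  moreover have "((\<lambda>x. \<gamma> / 2 * ((g x - h x) \<bullet> (g x - h x))) has_derivative
      (\<lambda>d. \<gamma> / 2 * ((g x - h x) \<bullet> (g' d - h' d) + (g' d - h' d) \<bullet> (g x - h x)))) (at x)"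
    using assms by (auto intro!: derivative_eq_intros)
  ultimately have "((\<lambda>x. f (g x ** transpose (h x)) + \<gamma> / 2 * ((g x - h x) \<bullet> (g x - h x)))
    has_derivative (\<lambda>d. (g x ** transpose (h' d) + g' d ** transpose (h x)) \<bullet> gradient f (g x ** transpose (h x))
      + \<gamma> / 2 * ((g x - h x) \<bullet> (g' d - h' d) + (g' d - h' d) \<bullet> (g x - h x)))) (at x)"
    by (rule has_derivative_add)
  then show ?thesis
    unfolding D_def power2_norm_eq_inner
    apply (rule has_derivative_eq_rhs)
    apply (rule ext)
    subgoal for d
      using inner_outer_right[of "gradient f (g x ** transpose (h x))" "g x" "h' d"]
        inner_outer_left[of "gradient f (g x ** transpose (h x))" "g' d" "h x"]
      by (simp add: gradient_outer_swap[of "h x" "g x"] inner_commute inner_add_right inner_add_left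
          inner_diff_left inner_diff_right algebra_simps)
    done
qed

lemma has_derivative_res [derivative_intros]:
  assumes "(g has_derivative g') (at x)" "(h has_derivative h') (at x)"
  shows "((\<lambda>x. res (g x) (h x)) has_derivative
    (\<lambda>d. lin_op A (g x ** transpose (h' d) + g' d ** transpose (h x)))) (at x)"
  unfolding res_def
  by (rule derivative_eq_intros bounded_linear.has_derivative[OF bounded_linear_lin_op]
      assms refl | simp)+

lemma inner_res_derivative:
  "y \<bullet> lin_op A (U ** transpose W + Z ** transpose V) = Z \<bullet> (adj y ** V) + W \<bullet> (adj y ** U)"
  using inner_outer_right[of "adj y" U W] inner_outer_left[of "adj y" Z V]
  by (simp add: inner_lin_op inner_add_right transpose_adj inner_commute)

text \<open>
  The first-order condition of a block minimization with arbitrary penalty weight \<open>\<sigma>\<close>: weight \<open>\<rho>\<close>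
  gives the ADMM steps, weight \<open>\<rho>/2\<close> and \<open>l = 0\<close> the minimizers of the merit function.
\<close>

lemma multiplier_if_minimum:
  assumes "\<And>W. D U V + l \<bullet> res U V + \<sigma> / 2 * (norm (res U V))\<^sup>2
      \<le> D U W + l \<bullet> res U W + \<sigma> / 2 * (norm (res U W))\<^sup>2"
  shows "multiplier U V (l + \<sigma> *\<^sub>R res U V)"
proof -
  let ?g = "\<lambda>W. D U W + l \<bullet> res U W + \<sigma> / 2 * (res U W \<bullet> res U W)"
  have "GDERIV ?g V :> gradient f (V ** transpose U) ** U + \<gamma> *\<^sub>R (V - U)
      + adj (l + \<sigma> *\<^sub>R res U V) ** U"
    unfolding gderiv_def
    apply (rule derivative_eq_intros refl)+
    apply (rule ext)
    subgoal for W
      using inner_res_derivative[of "l + \<sigma> *\<^sub>R res U V" U W 0 V]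
      by (simp add: inner_add_left inner_add_right inner_commute algebra_simps)
    done
  then have "gradient f (V ** transpose U) ** U + \<gamma> *\<^sub>R (V - U)
      + adj (l + \<sigma> *\<^sub>R res U V) ** U = 0"
    by (rule GDERIV_zero_at_minimum) (use assms in \<open>simp add: power2_norm_eq_inner\<close>)
  then show ?thesis by (simp add: multiplier_def)
qed

lemma GDERIV_aug_lagrangian:
  fixes U V :: "real^'r^'n"
  shows "GDERIV (aug_lagrangian f A b \<gamma> \<rho>) (U, V, l) :>
    (gradient f (U ** transpose V) ** V + \<gamma> *\<^sub>R (U - V) + adj (l + \<rho> *\<^sub>R res U V) ** V,
     gradient f (V ** transpose U) ** U + \<gamma> *\<^sub>R (V - U) + adj (l + \<rho> *\<^sub>R res U V) ** U,
     res U V)"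
proof -
  have eq: "aug_lagrangian f A b \<gamma> \<rho> = (\<lambda>z::(real^'r^'n) \<times> (real^'r^'n) \<times> (real^'m).
      D (fst z) (fst (snd z)) + snd (snd z) \<bullet> res (fst z) (fst (snd z))
      + \<rho> / 2 * (res (fst z) (fst (snd z)) \<bullet> res (fst z) (fst (snd z))))"
    by (auto simp: fun_eq_iff aug_lagrangian_eq_AL AL_def power2_norm_eq_inner)
  show ?thesis
    unfolding gderiv_def eq
    apply (rule derivative_eq_intros refl)+
    apply (rule ext)
    subgoal for z
      using inner_res_derivative[of "l + \<rho> *\<^sub>R res U V" U "fst (snd z)" "fst z" V]
      by (cases z) (simp add: inner_add_left inner_add_right inner_commute algebra_simps)
    done
qed

end

section \<open>Continuation of minima along a path\<close>

text \<open>
  A trapping argument. Let \<open>m s\<close> be the minimum of \<open>J (g s)\<close>. If \<open>m s\<close> can only lie at most at \<open>\<kappa>\<close>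
  or above the larger level \<open>B\<close>, then it cannot cross the gap while \<open>s\<close> runs through a
  connected interval: the set of \<open>s\<close> with \<open>m s \<le> \<kappa>\<close> is open by continuity and closed by
  compactness. It is used with bounds that are available only after membership in the level set at
  \<open>B\<close> is known.
\<close>

lemma minimum_continuation:
  fixes J :: "'a::metric_space \<Rightarrow> 'b::metric_space \<Rightarrow> real" and g :: "real \<Rightarrow> 'a"
  assumes cont: "continuous_on UNIV (\<lambda>z. J (fst z) (snd z))"
    and compact: "compact {(x, y). J x y \<le> B}"
    and path: "continuous_on {0..1} g"
    and less: "\<kappa> < B"
    and start: "\<exists>y. J (g 0) y \<le> \<kappa>"
    and step: "\<And>s y. s \<in> {0..1} \<Longrightarrow> (\<And>y'. J (g s) y \<le> J (g s) y') \<Longrightarrow> J (g s) y \<le> B \<Longrightarrow> J (g s) y \<le> \<kappa>"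
  shows "\<exists>y. J (g 1) y \<le> \<kappa>"
proof -
  define E where "E = {s \<in> {0..1}. \<exists>y. J (g s) y \<le> \<kappa>}"
  have E_if_less: "s \<in> E" if s: "s \<in> {0..1}" and y: "J (g s) y < B" for s y
  proof -
    let ?K = "{(x, y). J x y \<le> B} \<inter> {g s} \<times> UNIV"
    have "compact ?K" by (intro compact_Int_closed compact closed_Times) auto
    moreover have "continuous_on ?K (\<lambda>z. J (fst z) (snd z))"
      using cont continuous_on_subset by blast
    moreover have "(g s, y) \<in> ?K" using y by simp
    ultimately obtain z where z: "z \<in> ?K" "\<And>z'. z' \<in> ?K \<Longrightarrow> J (fst z) (snd z) \<le> J (fst z') (snd z')"
      by (metis (no_types, lifting) continuous_attains_inf empty_iff)
    then have fst: "fst z = g s" and le: "J (g s) (snd z) \<le> B" by auto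
    have "J (g s) (snd z) \<le> J (g s) y'" for y'
    proof (cases "J (g s) y' \<le> B")
      case True
      then show ?thesis using z(2)[of "(g s, y')"] fst by simp
    qed (use le in simp)
    then have "J (g s) (snd z) \<le> \<kappa>" using step s le by blast
    then show ?thesis using s by (auto simp: E_def)
  qed
  have E_eq: "E = (\<Union>y. {0..1} \<inter> (\<lambda>s. J (g s) y) -` {..<B})"
  proof (intro equalityI subsetI)
    fix s assume "s \<in> E"
    then obtain y where "s \<in> {0..1}" "J (g s) y < B"
      unfolding E_def using less by (auto intro: le_less_trans)
    then show "s \<in> (\<Union>y. {0..1} \<inter> (\<lambda>s. J (g s) y) -` {..<B})" by blast
  next
    fix s assume "s \<in> (\<Union>y. {0..1} \<inter> (\<lambda>s. J (g s) y) -` {..<B})"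
    then show "s \<in> E" using E_if_less by blast
  qed
  have cont_path: "continuous_on {0..1} (\<lambda>s. J (g s) y)" for y
    by (rule continuous_on_compose2[OF cont, of _ "\<lambda>s. (g s, y)", simplified])
      (intro continuous_intros path)
  have "openin (top_of_set {0..1}) E"
    unfolding E_eq
    by (rule openin_Union, elim imageE, simp only:)
      (intro continuous_openin_preimage_gen cont_path open_lessThan)
  moreover have "closedin (top_of_set {0..1}) E"
  proof -
    let ?P = "{0..1::real} \<times> snd ` {(x, y). J x y \<le> B}"
    let ?Q = "?P \<inter> (\<lambda>p. J (g (fst p)) (snd p)) -` {..\<kappa>}"
    have "compact ?P"
      by (intro compact_Times compact_Icc compact_continuous_image compact continuous_on_snd
          continuous_on_id)
    moreover have "continuous_on ?P (\<lambda>p. J (g (fst p)) (snd p))"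
    proof (rule continuous_on_compose2[OF cont, of _ "\<lambda>p. (g (fst p), snd p)", simplified])
      show "continuous_on ?P (\<lambda>p. (g (fst p), snd p))"
        by (intro continuous_on_Pair continuous_on_compose2[OF path] continuous_intros) auto
    qed
    ultimately have "closed ?Q" and P: "compact ?P"
      by (blast intro: continuous_closed_preimage compact_imp_closed closed_atMost)+
    from compact_Int_closed[OF P this(1)] have "compact ?Q"
      by (simp only: inf_left_idem)
    then have "compact (fst ` ?Q)"
      by (intro compact_continuous_image continuous_on_fst continuous_on_id)
    moreover have "fst ` ?Q = E"
    proof (intro equalityI subsetI)
      fix s assume "s \<in> E"
      then obtain y where "s \<in> {0..1}" "J (g s) y \<le> \<kappa>" by (auto simp: E_def)
      moreover then have "y \<in> snd ` {(x, y). J x y \<le> B}"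
        using less by (intro image_eqI[of _ _ "(g s, y)"]) auto
      ultimately show "s \<in> fst ` ?Q" by (intro image_eqI[of _ _ "(s, y)"]) auto
    qed (auto simp: E_def)
    ultimately show ?thesis
      by (intro closed_subset compact_imp_closed) (auto simp: E_def)
  qed
  moreover have "0 \<in> E" using start by (simp add: E_def)
  ultimately have "E = {0..1}"
    using connected_clopen[of "{0..1::real}"] by auto
  then have "1 \<in> E" by simp
  then show ?thesis by (simp add: E_def)
qed

section \<open>Estimates in the regular region\<close>

text \<open>
  The set \<open>G\<close> collects the single factors \<open>U\<close> for which all estimates hold. A factor belongs to it as
  soon as \<^emph>\<open>some\<close> partner makes the merit small; the pair formed by the two current ADMM iterates
  need not be such a pair.
\<close>

locale regular_problem = penalized_problem f A b \<gamma> \<rho>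
  for f :: "real^'n^'n \<Rightarrow> real" and A :: "'m::finite \<Rightarrow> real^'n^'n" and b :: "real^'m"
    and \<gamma> \<rho> :: real +
  fixes G :: "(real^'r^'n) set" and \<delta> \<eta> Lf L \<beta>hat :: real
  assumes delta_pos: "\<delta> > 0" and eta_pos: "\<eta> > 0" and L_nonneg: "L \<ge> 0"
    and norm_le_delta: "\<And>U. U \<in> G \<Longrightarrow> norm U \<le> \<delta>"
    and regular: "\<And>U y. U \<in> G \<Longrightarrow> \<eta> * norm y \<le> norm (adj y ** U)"
    and in_G: "\<And>U V. T U V \<le> \<beta>hat \<Longrightarrow> U \<in> G"
    and compact_T: "\<And>\<beta>. compact {(U :: real^'r^'n, V). T U V \<le> \<beta>}"
    and norm_gradient_le: "\<And>X. norm X \<le> \<delta>\<^sup>2 \<Longrightarrow> norm (gradient f X) \<le> Lf"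
    and gradient_lipschitz: "\<And>X Y. norm X \<le> \<delta>\<^sup>2 \<Longrightarrow> norm Y \<le> \<delta>\<^sup>2 \<Longrightarrow>
      norm (gradient f X - gradient f Y) \<le> L * norm (X - Y)"
    and c1_less: "const_c1 \<eta> \<delta> L Lf \<gamma> (\<Sum>i\<in>UNIV. (norm (A i))\<^sup>2) < \<rho> * \<gamma> / 2"
    and c2_less: "const_c2 \<eta> \<delta> L \<gamma> < \<rho> * \<gamma> / 2"
begin

abbreviation "c1 \<equiv> const_c1 \<eta> \<delta> L Lf \<gamma> (\<Sum>i\<in>UNIV. (norm (A i))\<^sup>2)"
abbreviation "c2 \<equiv> const_c2 \<eta> \<delta> L \<gamma>"

definition \<Lambda> :: real where
  "\<Lambda> = (Lf * \<delta> + 2 * \<gamma> * \<delta>) / \<eta>"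

lemma in_G': "T U V \<le> \<beta>hat \<Longrightarrow> V \<in> G"
  using in_G T_commute by metis

lemma Lf_nonneg: "Lf \<ge> 0"
  by (rule order_trans[OF norm_ge_zero norm_gradient_le[of 0]]) simp

lemma Lambda_nonneg: "\<Lambda> \<ge> 0"
  using Lf_nonneg delta_pos eta_pos gamma_pos by (simp add: \<Lambda>_def)

lemma norm_outer_le: "U \<in> G \<Longrightarrow> V \<in> G \<Longrightarrow> norm (V ** transpose U) \<le> \<delta>\<^sup>2"
  using norm_matrix_mult_le[of V "transpose U"] norm_le_delta[of U] norm_le_delta[of V]
  by (smt (verit) mult_mono' norm_ge_zero norm_transpose power2_eq_square)

lemma norm_multiplier_le:
  assumes "multiplier U V y" "U \<in> G" "V \<in> G"
  shows "norm y \<le> \<Lambda>"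
proof -
  have "adj y ** U = - (gradient f (V ** transpose U) ** U + \<gamma> *\<^sub>R (V - U))"
    by (rule adj_mult_multiplier[OF assms(1)])
  then have "norm (adj y ** U) \<le> norm (gradient f (V ** transpose U) ** U) + norm (\<gamma> *\<^sub>R (V - U))"
    by (metis norm_minus_cancel norm_triangle_ineq)
  also have "\<dots> \<le> Lf * \<delta> + \<gamma> * (\<delta> + \<delta>)"
  proof (rule add_mono)
    show "norm (gradient f (V ** transpose U) ** U) \<le> Lf * \<delta>"
      by (rule order_trans[OF norm_matrix_mult_le])
        (intro mult_mono norm_gradient_le norm_outer_le norm_le_delta assms Lf_nonneg norm_ge_zero)
    have "norm (V - U) \<le> \<delta> + \<delta>"
      by (rule order_trans[OF norm_triangle_ineq4]) (intro add_mono norm_le_delta assms)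
    then show "norm (\<gamma> *\<^sub>R (V - U)) \<le> \<gamma> * (\<delta> + \<delta>)"
      using gamma_pos by simp
  qed
  finally have "\<eta> * norm y \<le> Lf * \<delta> + 2 * \<gamma> * \<delta>"
    using regular[OF assms(2), of y] by (simp add: algebra_simps)
  then show ?thesis using eta_pos by (simp add: \<Lambda>_def field_simps)
qed

text \<open>
  Subtract the two stationarity equations and solve for \<open>adj (y - y') U\<close>; regularity of \<open>U\<close> inverts
  the map \<open>y \<mapsto> adj y U\<close>. The constants are those of the hypothesis on \<open>\<rho>\<close>, the sum of two terms being
  squared by \<open>(s + t)\<^sup>2 \<le> 2 s\<^sup>2 + 2 t\<^sup>2\<close>.
\<close>

lemma multiplier_lipschitz:
  assumes y: "multiplier U V y" "U \<in> G" "V \<in> G"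
    and y': "multiplier U' V' y'" "U' \<in> G" "V' \<in> G"
  shows "(norm (y - y'))\<^sup>2 \<le> c1 * (norm (U - U'))\<^sup>2 + c2 * (norm (V - V'))\<^sup>2"
proof -
  let ?s = "sqrt (\<Sum>i\<in>UNIV. (norm (A i))\<^sup>2)"
  let ?g = "gradient f (V ** transpose U)" and ?g' = "gradient f (V' ** transpose U')"
  define u v where "u = norm (U - U')" and "v = norm (V - V')"
  have uv: "u \<ge> 0" "v \<ge> 0" by (simp_all add: u_def v_def)
  have s: "?s \<ge> 0" by (simp add: sum_nonneg)
  have "adj y ** U = - (?g ** U + \<gamma> *\<^sub>R (V - U))"
    by (rule adj_mult_multiplier[OF y(1)])
  moreover have "adj y' ** U' = - (?g' ** U' + \<gamma> *\<^sub>R (V' - U'))"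
    by (rule adj_mult_multiplier[OF y'(1)])
  ultimately have eq: "adj (y - y') ** U = - (((?g - ?g') ** U + ?g' ** (U - U'))
      + \<gamma> *\<^sub>R ((V - V') - (U - U')) + adj y' ** (U - U'))"
    by (simp add: adj_diff matrix_mult_diff_left matrix_mult_diff_right algebra_simps)
  have "norm (V ** transpose U - V' ** transpose U') \<le> \<delta> * (v + u)"
    unfolding u_def v_def by (intro norm_outer_diff_le norm_le_delta assms)
  then have "norm (?g - ?g') \<le> L * (\<delta> * (v + u))"
    by (intro order_trans[OF gradient_lipschitz] mult_left_mono norm_outer_le assms L_nonneg)
  then have "norm ((?g - ?g') ** U) \<le> L * (\<delta> * (v + u)) * \<delta>"
    using norm_le_delta[OF y(2)] L_nonneg delta_pos uv
    by (intro order_trans[OF norm_matrix_mult_le] mult_mono) auto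
  moreover have "norm (?g' ** (U - U')) \<le> Lf * u"
    unfolding u_def
    by (intro order_trans[OF norm_matrix_mult_le] mult_right_mono norm_gradient_le norm_outer_le assms)
      auto
  moreover have "norm (\<gamma> *\<^sub>R ((V - V') - (U - U'))) \<le> \<gamma> * (v + u)"
    using gamma_pos norm_triangle_ineq4[of "V - V'" "U - U'"] by (simp add: u_def v_def)
  moreover have "norm (adj y' ** (U - U')) \<le> (?s * \<Lambda>) * u"
    unfolding u_def
    by (intro order_trans[OF norm_matrix_mult_le] mult_right_mono order_trans[OF norm_adj_le]
        mult_left_mono norm_multiplier_le[OF y'] s) auto
  ultimately have "norm (adj (y - y') ** U)
      \<le> (L * (\<delta> * (v + u)) * \<delta> + Lf * u) + \<gamma> * (v + u) + (?s * \<Lambda>) * u"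
    unfolding eq norm_minus_cancel by (intro norm_triangle_le add_mono) auto
  then have "\<eta> * norm (y - y') \<le> (L * \<delta>\<^sup>2 + Lf + \<gamma> + ?s * \<Lambda>) * u + (L * \<delta>\<^sup>2 + \<gamma>) * v"
    using regular[OF y(2), of "y - y'"] by (simp add: algebra_simps power2_eq_square)
  then have "(\<eta> * norm (y - y'))\<^sup>2 \<le> ((L * \<delta>\<^sup>2 + Lf + \<gamma> + ?s * \<Lambda>) * u + (L * \<delta>\<^sup>2 + \<gamma>) * v)\<^sup>2"
    using eta_pos by (intro power_mono) auto
  also have "\<dots> \<le> 2 * ((L * \<delta>\<^sup>2 + Lf + \<gamma> + ?s * \<Lambda>) * u)\<^sup>2 + 2 * ((L * \<delta>\<^sup>2 + \<gamma>) * v)\<^sup>2"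
    using sum_squares_bound[of "(L * \<delta>\<^sup>2 + Lf + \<gamma> + ?s * \<Lambda>) * u" "(L * \<delta>\<^sup>2 + \<gamma>) * v"]
    unfolding power2_sum by linarith
  also have "\<dots> = \<eta>\<^sup>2 * (c1 * u\<^sup>2 + c2 * v\<^sup>2)"
  proof -
    have "?s * \<Lambda> = 1 / \<eta> * Lf * \<delta> * ?s + 2 / \<eta> * \<gamma> * \<delta> * ?s"
      by (simp add: \<Lambda>_def add_divide_distrib algebra_simps)
    then have "c1 = 2 / \<eta>\<^sup>2 * (L * \<delta>\<^sup>2 + Lf + \<gamma> + ?s * \<Lambda>)\<^sup>2"
      by (simp only: const_c1_def add.assoc)
    then show ?thesis
      using eta_pos by (simp add: const_c2_def power_mult_distrib distrib_left)
  qed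
  finally show ?thesis using eta_pos by (simp add: power_mult_distrib u_def v_def)
qed

text \<open>
  The purpose of the lower bound on \<open>\<rho>\<close>: the change of a multiplier costs no more than what strong
  convexity gains from the same move.
\<close>

lemma multiplier_step_le:
  assumes "multiplier U V y" "U \<in> G" "V \<in> G" "multiplier U' V' y'" "U' \<in> G" "V' \<in> G"
  shows "(norm (y - y'))\<^sup>2 / \<rho> \<le> \<gamma> / 2 * (norm (U - U'))\<^sup>2 + \<gamma> / 2 * (norm (V - V'))\<^sup>2"
proof -
  have "(norm (y - y'))\<^sup>2 \<le> \<rho> * \<gamma> / 2 * (norm (U - U'))\<^sup>2 + \<rho> * \<gamma> / 2 * (norm (V - V'))\<^sup>2"
    using c1_less c2_less
    by (intro order_trans[OF multiplier_lipschitz[OF assms]] add_mono mult_right_mono) auto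
  then show ?thesis using rho_pos by (simp add: field_simps)
qed

lemma T_minimum_multiplier:
  assumes "\<And>W. T U V \<le> T U W"
  shows "multiplier U V ((\<rho> / 2) *\<^sub>R res U V)"
  using multiplier_if_minimum[of U V 0 "\<rho> / 2"] assms by (simp add: T_def)

text \<open>
  A new factor \<open>U'\<close> is judged with its best partner \<open>V'\<close>, not with the current \<open>V\<close>. Here \<open>c\<close> is a
  \<open>V\<close>-multiplier at the old pair and \<open>\<nu> = \<rho>/2 res U' V'\<close> is one at the new pair, so \<open>c - \<nu>\<close> is paid for
  by the moves from \<open>U\<close> to \<open>U'\<close> and from \<open>V\<close> to \<open>V'\<close>; what remains is at most \<open>B\<close> by Young's
  inequality.
\<close>

lemma T_after_U_step:
  assumes c: "multiplier U V c" "U \<in> G" "V \<in> G"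
    and le: "AL U' V c \<le> B - \<gamma> / 2 * (norm (U' - U))\<^sup>2"
    and min: "\<And>W. T U' V' \<le> T U' W" and "T U' V' \<le> \<beta>hat"
  shows "T U' V' \<le> B"
proof -
  define r s \<nu> where "r = res U' V" and "s = res U' V'" and "\<nu> = (\<rho> / 2) *\<^sub>R s"
  have \<nu>: "multiplier U' V' \<nu>"
    using T_minimum_multiplier[OF min] by (simp add: \<nu>_def s_def)
  have "U' \<in> G" "V' \<in> G" using assms(6) in_G in_G' by blast+
  then have "(norm (c - \<nu>))\<^sup>2 / \<rho> \<le> \<gamma> / 2 * (norm (U' - U))\<^sup>2 + \<gamma> / 2 * (norm (V - V'))\<^sup>2"
    using multiplier_step_le[OF c \<nu>] by (simp add: norm_minus_commute)
  moreover have "D U' V' + \<gamma> / 2 * (norm (V - V'))\<^sup>2 \<le> D U' V + \<nu> \<bullet> r - \<nu> \<bullet> s"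
    using multiplier_growth[OF \<nu>, of V] by (simp add: r_def s_def inner_diff_right)
  moreover have "\<nu> \<bullet> s = \<rho> / 2 * (norm s)\<^sup>2"
    by (simp add: \<nu>_def power2_norm_eq_inner)
  moreover have "\<nu> \<bullet> r - c \<bullet> r \<le> (norm (c - \<nu>))\<^sup>2 / \<rho> + \<rho> / 2 * (norm r)\<^sup>2"
  proof -
    have "(\<nu> - c) \<bullet> r \<le> (norm (\<nu> - c))\<^sup>2 / (2 * \<rho>) + \<rho> / 2 * (norm r)\<^sup>2"
      by (rule inner_le_young[OF rho_pos])
    also have "(norm (\<nu> - c))\<^sup>2 / (2 * \<rho>) \<le> (norm (c - \<nu>))\<^sup>2 / \<rho>"
      using rho_pos by (simp add: norm_minus_commute field_simps)
    finally show ?thesis by (simp add: inner_diff_left)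
  qed
  moreover have "0 \<le> \<rho> * (norm s)\<^sup>2" using rho_pos by simp
  ultimately show ?thesis
    using le unfolding T_def AL_def r_def[symmetric] s_def[symmetric] by linarith
qed

text \<open>
  The potential that controls the half steps, where \<open>c\<close> is the current dual variable and \<open>\<mu>\<close> the
  multiplier of the following minimization in \<open>U\<close>. Its quadratic form is
  \<open>\<parallel>\<mu>\<parallel>\<^sup>2/2 - \<parallel>c\<parallel>\<^sup>2/2 + \<parallel>\<mu> - c\<parallel>\<^sup>2\<close>, the one of the augmented Lagrangian plus \<open>\<parallel>\<mu> - c\<parallel>\<^sup>2\<close>.
\<close>

definition energy :: "real^'r^'n \<Rightarrow> real^'r^'n \<Rightarrow> real^'m \<Rightarrow> real^'m \<Rightarrow> real" where
  "energy U V c \<mu> = D U V + (3 / 2 * (norm \<mu>)\<^sup>2 - 2 * (\<mu> \<bullet> c) + (norm c)\<^sup>2 / 2) / \<rho>"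

text \<open>
  The counterpart for a new factor \<open>V'\<close>, again judged with its best partner. Here \<open>U\<close> has just been
  minimized, so the multipliers to be compared are \<open>\<mu> = c + \<rho> res U V\<close> and
  \<open>\<nu> = \<rho>/2 res U' V'\<close>, both of the \<open>U\<close>-type, while the dual variable \<open>c\<close> may be far from both. The
  energy exceeds the resulting bound by \<open>(\<parallel>2\<mu> - c - \<nu>\<parallel>\<^sup>2/2 + \<parallel>\<nu>\<parallel>\<^sup>2)/\<rho>\<close>.
\<close>

lemma T_after_V_step:
  assumes \<mu>: "multiplier V U (c + \<rho> *\<^sub>R res U V)" "V \<in> G" "U \<in> G"
    and le: "AL U V' c \<le> AL U V c - \<gamma> / 2 * (norm (V' - V))\<^sup>2"
    and min: "\<And>W. T U' V' \<le> T W V'" and "T U' V' \<le> \<beta>hat"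
  shows "T U' V' \<le> energy U V c (c + \<rho> *\<^sub>R res U V)"
proof -
  define \<mu> where "\<mu> = c + \<rho> *\<^sub>R res U V"
  define r s \<nu> where "r = res U V'" and "s = res U' V'" and "\<nu> = (\<rho> / 2) *\<^sub>R s"
  have \<nu>: "multiplier V' U' \<nu>"
    using T_minimum_multiplier[of V' U'] min
    by (simp add: \<nu>_def s_def T_commute[of V'] res_commute[of V'])
  have "U' \<in> G" "V' \<in> G" using assms(6) in_G in_G' by blast+
  then have "(norm (\<mu> - \<nu>))\<^sup>2 / \<rho> \<le> \<gamma> / 2 * (norm (V' - V))\<^sup>2 + \<gamma> / 2 * (norm (U - U'))\<^sup>2"
    using multiplier_step_le[OF \<mu> \<nu>] by (simp add: norm_minus_commute \<mu>_def)
  moreover have "D U' V' + \<gamma> / 2 * (norm (U - U'))\<^sup>2 \<le> D U V' + \<nu> \<bullet> r - \<nu> \<bullet> s"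
    using multiplier_growth[OF \<nu>, of U]
    by (simp add: r_def s_def inner_diff_right D_commute[of V'] res_commute[of V'])
  moreover have "\<nu> \<bullet> s = \<rho> / 2 * (norm s)\<^sup>2" "(norm \<nu>)\<^sup>2 / \<rho> = \<rho> / 4 * (norm s)\<^sup>2"
    using rho_pos
    by (simp add: \<nu>_def power2_norm_eq_inner,
        simp add: \<nu>_def power_divide power_mult_distrib power2_eq_square[of \<rho>] field_simps)
  moreover have "\<nu> \<bullet> r - c \<bullet> r \<le> (norm (\<nu> - c))\<^sup>2 / (2 * \<rho>) + \<rho> / 2 * (norm r)\<^sup>2"
    using inner_le_young[OF rho_pos, of "\<nu> - c" r] by (simp add: inner_diff_left)
  moreover have "AL U V' c = D U V' + c \<bullet> r + \<rho> / 2 * (norm r)\<^sup>2"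
    by (simp add: AL_def r_def)
  moreover have "T U' V' = D U' V' + \<rho> / 4 * (norm s)\<^sup>2"
    by (simp add: T_def s_def)
  ultimately have "T U' V' \<le> AL U V c - (norm (\<mu> - \<nu>))\<^sup>2 / \<rho> + (norm (\<nu> - c))\<^sup>2 / (2 * \<rho>)
      - (norm \<nu>)\<^sup>2 / \<rho>"
    using le by linarith
  moreover have "energy U V c \<mu> - (AL U V c - (norm (\<mu> - \<nu>))\<^sup>2 / \<rho> + (norm (\<nu> - c))\<^sup>2 / (2 * \<rho>)
      - (norm \<nu>)\<^sup>2 / \<rho>) = (norm (2 *\<^sub>R \<mu> - c - \<nu>))\<^sup>2 / (2 * \<rho>) + (norm \<nu>)\<^sup>2 / \<rho>"
  proof -
    have squares: "(norm (2 *\<^sub>R \<mu> - c - \<nu>))\<^sup>2 = 4 * (norm \<mu>)\<^sup>2 + (norm c)\<^sup>2 + (norm \<nu>)\<^sup>2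
        - 4 * (\<mu> \<bullet> c) - 4 * (\<mu> \<bullet> \<nu>) + 2 * (c \<bullet> \<nu>)"
      "(norm (\<mu> - \<nu>))\<^sup>2 = (norm \<mu>)\<^sup>2 + (norm \<nu>)\<^sup>2 - 2 * (\<mu> \<bullet> \<nu>)"
      "(norm (\<nu> - c))\<^sup>2 = (norm c)\<^sup>2 + (norm \<nu>)\<^sup>2 - 2 * (c \<bullet> \<nu>)"
      by (simp_all add: power2_norm_eq_inner inner_diff_left inner_diff_right inner_commute)
    show ?thesis
      using rho_pos unfolding energy_def AL_eq \<mu>_def[symmetric] squares
      by (simp add: field_simps)
  qed
  moreover have "0 \<le> (norm (2 *\<^sub>R \<mu> - c - \<nu>))\<^sup>2 / (2 * \<rho>) + (norm \<nu>)\<^sup>2 / \<rho>"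
    using rho_pos by simp
  ultimately show ?thesis by (simp add: \<mu>_def)
qed

end

context regular_problem
begin

text \<open>
  The augmented Lagrangian dominates the merit function up to a constant, and all level sets of the
  latter are compact.
\<close>

lemma exists_AL_minimum: "\<exists>W. \<forall>W'. AL W V l \<le> AL W' V l"
  for V :: "real^'r^'n"
proof -
  define B where "B = AL V V l + (norm l)\<^sup>2 / \<rho>"
  let ?K = "{(X :: real^'r^'n, Y). T X Y \<le> B} \<inter> UNIV \<times> {V}"
  have "compact ?K" by (intro compact_Int_closed compact_T closed_Times) auto
  moreover have "continuous_on ?K (\<lambda>z. AL (fst z) (snd z) l)"
    unfolding AL_def by (intro continuous_intros)
  moreover have "(V, V) \<in> ?K" using T_le_AL by (simp add: B_def)
  ultimately obtain z where z: "z \<in> ?K"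
    "\<And>z'. z' \<in> ?K \<Longrightarrow> AL (fst z) (snd z) l \<le> AL (fst z') (snd z') l"
    by (metis (no_types, lifting) continuous_attains_inf empty_iff)
  then have snd: "snd z = V" by auto
  have "AL (fst z) V l \<le> AL W' V l" for W'
  proof (cases "T W' V \<le> B")
    case True
    then show ?thesis using z(2)[of "(W', V)"] snd by simp
  next
    case False
    then have "AL V V l \<le> AL W' V l" using T_le_AL[of W' V l] by (simp add: B_def)
    moreover have "AL (fst z) V l \<le> AL V V l"
      using z(2)[of "(V, V)"] \<open>(V, V) \<in> ?K\<close> snd by simp
    ultimately show ?thesis by simp
  qed
  then show ?thesis by blast
qed

text \<open>
  Strong monotonicity in the dual parameter: the minimizer of the augmented Lagrangian in one block
  is unique and depends on \<open>l\<close> in a Lipschitz way.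
\<close>

lemma multiplier_path_lipschitz:
  assumes "multiplier V X (l + \<rho> *\<^sub>R res X V)" "multiplier V Y (l' + \<rho> *\<^sub>R res Y V)"
  shows "norm (X - Y) \<le> norm (l - l') / sqrt (4 * \<rho> * \<gamma>)"
proof -
  let ?r = "res Y V - res X V"
  have "D V X + \<gamma> / 2 * (norm (Y - X))\<^sup>2 \<le> D V Y + (l + \<rho> *\<^sub>R res X V) \<bullet> ?r"
    using multiplier_growth[OF assms(1), of Y] by (simp add: res_commute[of V])
  moreover have "D V Y + \<gamma> / 2 * (norm (X - Y))\<^sup>2 \<le> D V X - (l' + \<rho> *\<^sub>R res Y V) \<bullet> ?r"
    using multiplier_growth[OF assms(2), of X] by (simp add: res_commute[of V] inner_diff_right)
  moreover have "(l + \<rho> *\<^sub>R res X V) \<bullet> ?r - (l' + \<rho> *\<^sub>R res Y V) \<bullet> ?r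
      = (l - l') \<bullet> ?r - \<rho> * (norm ?r)\<^sup>2"
    by (simp add: power2_norm_eq_inner inner_diff_left inner_diff_right inner_add_left
        inner_commute algebra_simps)
  moreover have "(l - l') \<bullet> ?r \<le> (norm (l - l'))\<^sup>2 / (2 * (2 * \<rho>)) + 2 * \<rho> / 2 * (norm ?r)\<^sup>2"
    by (rule inner_le_young) (use rho_pos in simp)
  ultimately have "\<gamma> * (norm (X - Y))\<^sup>2 \<le> (norm (l - l'))\<^sup>2 / (4 * \<rho>)"
    by (simp add: norm_minus_commute)
  then have "(norm (X - Y))\<^sup>2 \<le> (norm (l - l') / sqrt (4 * \<rho> * \<gamma>))\<^sup>2"
    using rho_pos gamma_pos by (simp add: power_divide field_simps)
  then show ?thesis
    by (rule power2_le_imp_le) (use rho_pos gamma_pos in simp)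
qed

end

section \<open>The ADMM iteration\<close>

locale admm_run = regular_problem f A b \<gamma> \<rho> G \<delta> \<eta> Lf L \<beta>hat
  for f :: "real^'n^'n \<Rightarrow> real" and A :: "'m::finite \<Rightarrow> real^'n^'n" and b :: "real^'m"
    and \<gamma> \<rho> :: real and G :: "(real^'r^'n) set" and \<delta> \<eta> Lf L \<beta>hat :: real +
  fixes U V :: "nat \<Rightarrow> real^'r^'n" and lam :: "nat \<Rightarrow> real^'m" and \<beta>\<^sub>0 :: real
  assumes init: "AL (U 0) (V 0) (lam 0) + (norm (lam 0))\<^sup>2 / \<rho> \<le> \<beta>\<^sub>0"
    and level_less: "\<beta>\<^sub>0 + \<Lambda>\<^sup>2 / \<rho> < \<beta>hat"
    and U_min: "\<And>k W. AL (U (Suc k)) (V k) (lam k) \<le> AL W (V k) (lam k)"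
    and V_min: "\<And>k W. AL (U (Suc k)) (V (Suc k)) (lam k) \<le> AL (U (Suc k)) W (lam k)"
    and lam_step: "\<And>k. lam (Suc k) = lam k + \<rho> *\<^sub>R res (U (Suc k)) (V (Suc k))"
begin

definition \<kappa> :: real where "\<kappa> = \<beta>\<^sub>0 + \<Lambda>\<^sup>2 / \<rho>"

text \<open>
  The multiplier produced by the minimization in \<open>U\<close>; the one produced by the minimization in \<open>V\<close> is
  the next dual variable itself.
\<close>

definition \<mu> :: "nat \<Rightarrow> real^'m" where
  "\<mu> k = lam k + \<rho> *\<^sub>R res (U (Suc k)) (V k)"

lemma kappa_less: "\<kappa> < \<beta>hat"
  using level_less by (simp add: \<kappa>_def)

lemma le_kappa: "x \<le> \<beta>\<^sub>0 + y / \<rho> \<Longrightarrow> y \<le> \<Lambda>\<^sup>2 \<Longrightarrow> x \<le> \<kappa>"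
  using rho_pos divide_right_mono[of y "\<Lambda>\<^sup>2" \<rho>] by (simp add: \<kappa>_def)

lemma in_G_kappa: "T X Y \<le> \<kappa> \<Longrightarrow> X \<in> G" "T X Y \<le> \<kappa> \<Longrightarrow> Y \<in> G"
  using in_G[of X Y] in_G'[of X Y] kappa_less by simp_all

lemma multiplier_lam: "multiplier (U (Suc k)) (V (Suc k)) (lam (Suc k))"
  using multiplier_if_minimum[of "U (Suc k)" "V (Suc k)" "lam k" \<rho>] V_min
  by (simp add: AL_def lam_step)

lemma multiplier_\<mu>: "multiplier (V k) (U (Suc k)) (\<mu> k)"
  using multiplier_if_minimum[of "V k" "U (Suc k)" "lam k" \<rho>] U_min
  by (simp add: AL_def \<mu>_def D_commute[of "V k"] res_commute[of "V k"])

lemma res_V_step: "res (U (Suc k)) (V (Suc k)) = (1 / \<rho>) *\<^sub>R (lam (Suc k) - lam k)"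
  using rho_pos by (simp add: lam_step)

lemma res_U_step: "res (U (Suc k)) (V k) = (1 / \<rho>) *\<^sub>R (\<mu> k - lam k)"
  using rho_pos by (simp add: \<mu>_def)

lemma U_descent_segment:
  assumes "s \<in> {0..1}"
  shows "AL (U k + s *\<^sub>R (U (Suc k) - U k)) (V k) (lam k)
    + \<gamma> / 2 * (norm (U k + s *\<^sub>R (U (Suc k) - U k) - U k))\<^sup>2 \<le> AL (U k) (V k) (lam k)"
  using AL_growth_segment[of "V k" "U (Suc k)" "lam k" s "U k"] multiplier_\<mu> assms
  by (simp add: AL_commute[of "V k"] res_commute[of "V k"] \<mu>_def)

lemma U_descent:
  "AL (U (Suc k)) (V k) (lam k) + \<gamma> / 2 * (norm (U (Suc k) - U k))\<^sup>2 \<le> AL (U k) (V k) (lam k)"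
  using U_descent_segment[of 1 k] by simp

lemma V_descent_segment:
  assumes "s \<in> {0..1}"
  shows "AL (U (Suc k)) (V k + s *\<^sub>R (V (Suc k) - V k)) (lam k)
    + \<gamma> / 2 * (norm (V k + s *\<^sub>R (V (Suc k) - V k) - V k))\<^sup>2 \<le> AL (U (Suc k)) (V k) (lam k)"
  using AL_growth_segment[of "U (Suc k)" "V (Suc k)" "lam k" s "V k"] multiplier_lam assms
  by (simp add: lam_step)

lemma V_descent:
  "AL (U (Suc k)) (V (Suc k)) (lam k) + \<gamma> / 2 * (norm (V (Suc k) - V k))\<^sup>2
    \<le> AL (U (Suc k)) (V k) (lam k)"
  using V_descent_segment[of 1 k] by simp

lemma dual_step:
  "AL (U (Suc k)) (V (Suc k)) (lam (Suc k))
    = AL (U (Suc k)) (V (Suc k)) (lam k) + (norm (lam (Suc k) - lam k))\<^sup>2 / \<rho>"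
  using rho_pos
  by (simp add: AL_def lam_step[of k] inner_add_left power2_norm_eq_inner[symmetric]
      power_mult_distrib power2_eq_square[of \<rho>])

section \<open>The first iteration\<close>

lemma first_V_level: "T (U (Suc 0)) (V (Suc 0)) \<le> \<beta>\<^sub>0"
  using T_le_AL[of "U (Suc 0)" "V (Suc 0)" "lam 0"] U_min[of 0 "U 0"] V_min[of 0 "V 0"] init
  by simp

lemma level0_le_kappa: "\<beta>\<^sub>0 \<le> \<kappa>"
  using rho_pos by (simp add: \<kappa>_def)

lemma first_in_G: "U (Suc 0) \<in> G" "V (Suc 0) \<in> G"
  using first_V_level level0_le_kappa in_G_kappa order_trans by blast+

text \<open>
  The initial dual variable need not be a multiplier of any pair, so \<open>\<Lambda>\<close> does not bound it.
  What compensates for it is that a large \<open>lam 0\<close> leaves little room for the objective.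
\<close>

lemma first_D_le:
  "D (U (Suc 0)) (V (Suc 0)) \<le> \<beta>\<^sub>0 - ((norm (lam 0))\<^sup>2 + (norm (lam (Suc 0)))\<^sup>2) / (2 * \<rho>)"
proof -
  have "AL (U (Suc 0)) (V (Suc 0)) (lam 0) + (norm (lam 0))\<^sup>2 / \<rho> \<le> \<beta>\<^sub>0"
    using U_min[of 0 "U 0"] V_min[of 0 "V 0"] init by simp
  then show ?thesis
    using rho_pos unfolding AL_eq lam_step[symmetric] by (simp add: field_simps)
qed

lemma norm_lam1_le: "norm (lam (Suc 0)) \<le> \<Lambda>"
  using norm_multiplier_le multiplier_lam first_in_G by blast

text \<open>
  The case \<open>s = 1\<close> is that of the second iterate, \<open>W = U 2\<close>. Multiplied by \<open>\<rho>\<close>, the objective is bounded by a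
  quadratic form in \<open>a\<close>, \<open>c\<close> and \<open>m\<close>; maximizing over the uncontrolled \<open>a = lam 0\<close> gives \<open>a = - m\<close>.
\<close>

lemma first_path_bound:
  fixes m :: "real^'m"
  assumes m: "multiplier (V (Suc 0)) W m" "m = s *\<^sub>R lam (Suc 0) + \<rho> *\<^sub>R res W (V (Suc 0))"
  defines "a \<equiv> lam 0" and "c \<equiv> lam (Suc 0)"
  shows "D W (V (Suc 0)) + \<gamma> / 2 * (norm (W - U (Suc 0)))\<^sup>2
      \<le> \<beta>\<^sub>0 + (- (norm a)\<^sup>2 / 2 - (norm c)\<^sup>2 / 2 + m \<bullet> ((1 + s) *\<^sub>R c - a - m)) / \<rho>"
    and "T W (V (Suc 0)) \<le> \<beta>\<^sub>0 + ((1 + s) / 2 * (m \<bullet> c) - (1 - s\<^sup>2) / 4 * (norm c)\<^sup>2) / \<rho>"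
proof -
  have r1: "res (U (Suc 0)) (V (Suc 0)) = (1 / \<rho>) *\<^sub>R (c - a)"
    by (simp add: res_V_step a_def c_def)
  have r: "res W (V (Suc 0)) = (1 / \<rho>) *\<^sub>R (m - s *\<^sub>R c)"
    using rho_pos m(2) by (simp add: c_def)
  have "D W (V (Suc 0)) + \<gamma> / 2 * (norm (W - U (Suc 0)))\<^sup>2
      \<le> D (U (Suc 0)) (V (Suc 0)) + m \<bullet> (res (U (Suc 0)) (V (Suc 0)) - res W (V (Suc 0)))"
    using multiplier_growth[OF m(1), of "U (Suc 0)"]
    by (simp add: D_commute[of "V (Suc 0)"] res_commute[of "V (Suc 0)"] norm_minus_commute)
  also have "\<dots> \<le> \<beta>\<^sub>0 - ((norm a)\<^sup>2 + (norm c)\<^sup>2) / (2 * \<rho>)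
      + m \<bullet> ((1 / \<rho>) *\<^sub>R (c - a) - (1 / \<rho>) *\<^sub>R (m - s *\<^sub>R c))"
    using first_D_le unfolding r1 r a_def c_def by simp
  also have "\<dots> = \<beta>\<^sub>0 + (- (norm a)\<^sup>2 / 2 - (norm c)\<^sup>2 / 2 + m \<bullet> ((1 + s) *\<^sub>R c - a - m)) / \<rho>"
    using rho_pos by (simp add: inner_diff_right inner_add_right field_simps)
  finally show D: "D W (V (Suc 0)) + \<gamma> / 2 * (norm (W - U (Suc 0)))\<^sup>2
      \<le> \<beta>\<^sub>0 + (- (norm a)\<^sup>2 / 2 - (norm c)\<^sup>2 / 2 + m \<bullet> ((1 + s) *\<^sub>R c - a - m)) / \<rho>" .
  have "T W (V (Suc 0)) = D W (V (Suc 0)) + (norm (m - s *\<^sub>R c))\<^sup>2 / 4 / \<rho>"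
    using rho_pos unfolding T_def r norm_scaleR power_mult_distrib power2_abs
    by (simp add: power_divide power2_eq_square[of \<rho>])
  moreover have "0 \<le> \<gamma> / 2 * (norm (W - U (Suc 0)))\<^sup>2" using gamma_pos by simp
  ultimately have "T W (V (Suc 0)) \<le> \<beta>\<^sub>0 + (- (norm a)\<^sup>2 / 2 - (norm c)\<^sup>2 / 2
      + m \<bullet> ((1 + s) *\<^sub>R c - a - m) + (norm (m - s *\<^sub>R c))\<^sup>2 / 4) / \<rho>"
    using D by (simp add: add_divide_distrib)
  moreover have "- (norm a)\<^sup>2 / 2 - (norm c)\<^sup>2 / 2
      + m \<bullet> ((1 + s) *\<^sub>R c - a - m) + (norm (m - s *\<^sub>R c))\<^sup>2 / 4
    = (1 + s) / 2 * (m \<bullet> c) - (1 - s\<^sup>2) / 4 * (norm c)\<^sup>2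
      - (norm (a + m))\<^sup>2 / 2 - (norm (c - m))\<^sup>2 / 4"
    unfolding power2_norm_eq_inner
    by (simp add: inner_diff_left inner_diff_right inner_add_left inner_add_right inner_commute
        power2_eq_square field_simps)
  moreover have "\<dots> \<le> (1 + s) / 2 * (m \<bullet> c) - (1 - s\<^sup>2) / 4 * (norm c)\<^sup>2"
    using zero_le_power2[of "norm (a + m)"] zero_le_power2[of "norm (c - m)"] by linarith
  ultimately show "T W (V (Suc 0)) \<le> \<beta>\<^sub>0 + ((1 + s) / 2 * (m \<bullet> c) - (1 - s\<^sup>2) / 4 * (norm c)\<^sup>2) / \<rho>"
    using rho_pos by (smt (verit) divide_right_mono)
qed

lemma inner_le_Lambda: "norm x \<le> \<Lambda> \<Longrightarrow> norm y \<le> \<Lambda> \<Longrightarrow> x \<bullet> y \<le> \<Lambda>\<^sup>2"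
  for x y :: "real^'m"
  using norm_cauchy_schwarz[of x y] mult_mono[of "norm x" \<Lambda> "norm y" \<Lambda>] Lambda_nonneg
  by (simp add: power2_eq_square)

text \<open>
  Inside the region at level \<open>\<beta>hat\<close> the multiplier is bounded by \<open>\<Lambda>\<close>, and then the merit is in fact
  at most \<open>\<kappa> < \<beta>hat\<close>.
\<close>

lemma first_path_trapped:
  assumes s: "s \<in> {0..1}" and m: "multiplier (V (Suc 0)) W (s *\<^sub>R lam (Suc 0) + \<rho> *\<^sub>R res W (V (Suc 0)))"
    and le: "T W (V (Suc 0)) \<le> \<beta>hat"
  shows "T W (V (Suc 0)) \<le> \<kappa>"
proof -
  let ?m = "s *\<^sub>R lam (Suc 0) + \<rho> *\<^sub>R res W (V (Suc 0))" and ?c = "lam (Suc 0)"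
  have "norm ?m \<le> \<Lambda>"
    using norm_multiplier_le[OF m] in_G[OF le] in_G'[OF le] by blast
  then have mc: "?m \<bullet> ?c \<le> \<Lambda>\<^sup>2" by (rule inner_le_Lambda[OF _ norm_lam1_le])
  have "s\<^sup>2 \<le> 1" using s by (simp add: power_le_one)
  then have "0 \<le> (1 - s\<^sup>2) / 4 * (norm ?c)\<^sup>2" by simp
  moreover have "(1 + s) / 2 * (?m \<bullet> ?c) \<le> (1 + s) / 2 * \<Lambda>\<^sup>2"
    using s mc by (intro mult_left_mono) auto
  moreover have "(1 + s) / 2 * \<Lambda>\<^sup>2 \<le> 1 * \<Lambda>\<^sup>2"
    using s by (intro mult_right_mono) auto
  ultimately have "(1 + s) / 2 * (?m \<bullet> ?c) - (1 - s\<^sup>2) / 4 * (norm ?c)\<^sup>2 \<le> \<Lambda>\<^sup>2" by linarith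
  then show ?thesis by (rule le_kappa[OF first_path_bound(2)[OF m refl]])
qed

text \<open>
  The start of the path: at \<open>s = 0\<close> the quadratic form is at most \<open>\<parallel>lam 1\<parallel>\<^sup>2/2\<close>, however large \<open>m\<close> is.
\<close>

lemma first_path_start:
  assumes "multiplier (V (Suc 0)) W (\<rho> *\<^sub>R res W (V (Suc 0)))"
  shows "T W (V (Suc 0)) \<le> \<kappa>"
proof -
  define m where "m = \<rho> *\<^sub>R res W (V (Suc 0))"
  let ?c = "lam (Suc 0)" and ?a = "lam 0"
  have m: "multiplier (V (Suc 0)) W m" using assms by (simp add: m_def)
  have "0 \<le> \<gamma> / 2 * (norm (W - U (Suc 0)))\<^sup>2" using gamma_pos by simp
  then have "D W (V (Suc 0)) \<le> \<beta>\<^sub>0 + (- (norm ?a)\<^sup>2 / 2 - (norm ?c)\<^sup>2 / 2 + m \<bullet> (?c - ?a - m)) / \<rho>"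
    using first_path_bound(1)[OF m, of 0] by (simp add: m_def[symmetric])
  moreover have "T W (V (Suc 0)) = D W (V (Suc 0)) + (norm m)\<^sup>2 / 4 / \<rho>"
    using rho_pos by (simp add: T_def m_def power_mult_distrib power2_eq_square[of \<rho>])
  ultimately have "T W (V (Suc 0)) \<le> \<beta>\<^sub>0 + (- (norm ?a)\<^sup>2 / 2 - (norm ?c)\<^sup>2 / 2
      + m \<bullet> (?c - ?a - m) + (norm m)\<^sup>2 / 4) / \<rho>"
    by (simp add: add_divide_distrib)
  moreover have "- (norm ?a)\<^sup>2 / 2 - (norm ?c)\<^sup>2 / 2 + m \<bullet> (?c - ?a - m) + (norm m)\<^sup>2 / 4
    = (norm ?c)\<^sup>2 / 2 - (norm (?a + m))\<^sup>2 / 2 - (norm (2 *\<^sub>R ?c - m))\<^sup>2 / 4"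
    unfolding power2_norm_eq_inner
    by (simp only: inner_diff_left inner_diff_right inner_add_left inner_add_right inner_commute
        inner_scaleR_left inner_scaleR_right) (simp add: inner_commute field_simps)
  moreover have "(norm ?c)\<^sup>2 / 2 - (norm (?a + m))\<^sup>2 / 2 - (norm (2 *\<^sub>R ?c - m))\<^sup>2 / 4 \<le> \<Lambda>\<^sup>2"
  proof -
    have "(norm ?c)\<^sup>2 \<le> \<Lambda>\<^sup>2" using norm_lam1_le by (intro power_mono) auto
    moreover have "0 \<le> (norm ?c)\<^sup>2" "0 \<le> (norm (?a + m))\<^sup>2" "0 \<le> (norm (2 *\<^sub>R ?c - m))\<^sup>2" by simp_all
    ultimately show ?thesis by linarith
  qed
  ultimately show ?thesis using le_kappa by metis
qed

text \<open>
  The bound on the merit of \<open>(U 2, V 1)\<close> presupposes a bound on the multiplier, which in turn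
  presupposes that the merit is small. The circle is broken by deforming the dual variable
  from \<open>0\<close> to \<open>lam 1\<close>: the minimizers form a continuous path that cannot jump from level \<open>\<kappa>\<close>
  over level \<open>\<beta>hat\<close>.
\<close>

lemma second_U_level: "T (U (Suc (Suc 0))) (V (Suc 0)) \<le> \<kappa>"
proof -
  have "\<exists>W. multiplier (V (Suc 0)) W (s *\<^sub>R lam (Suc 0) + \<rho> *\<^sub>R res W (V (Suc 0)))" for s
  proof -
    obtain W where "\<And>W'. AL W (V (Suc 0)) (s *\<^sub>R lam (Suc 0)) \<le> AL W' (V (Suc 0)) (s *\<^sub>R lam (Suc 0))"
      using exists_AL_minimum by blast
    then have "multiplier (V (Suc 0)) W (s *\<^sub>R lam (Suc 0) + \<rho> *\<^sub>R res (V (Suc 0)) W)"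
      by (intro multiplier_if_minimum) (simp add: AL_def D_commute[of "V (Suc 0)"] res_commute[of "V (Suc 0)"])
    then show ?thesis by (auto simp: res_commute[of "V (Suc 0)"])
  qed
  then obtain W where W: "\<And>s. multiplier (V (Suc 0)) (W s) (s *\<^sub>R lam (Suc 0) + \<rho> *\<^sub>R res (W s) (V (Suc 0)))"
    by metis
  define \<tau> where "\<tau> s = T (W s) (V (Suc 0))" for s
  let ?C = "norm (lam (Suc 0)) / sqrt (4 * \<rho> * \<gamma>)"
  have "?C-lipschitz_on {0..1} W"
  proof (rule lipschitz_onI)
    show "dist (W s) (W t) \<le> ?C * dist s t" for s t
      using multiplier_path_lipschitz[OF W[of s] W[of t]]
      by (simp add: dist_norm mult.commute flip: scaleR_diff_left)
  qed (use rho_pos gamma_pos in simp)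
  then have "continuous_on {0..1} \<tau>"
    unfolding \<tau>_def by (intro continuous_intros lipschitz_on_continuous_on)
  moreover have "\<tau> 0 \<le> \<kappa>"
    using first_path_start[of "W 0"] W[of 0] by (simp add: \<tau>_def)
  moreover have trapped: "\<tau> s \<le> \<kappa>" if "s \<in> {0..1}" "\<tau> s \<le> \<beta>hat" for s
    using first_path_trapped[OF that(1) W] that(2) by (simp add: \<tau>_def)
  ultimately have "\<tau> 1 \<le> \<beta>hat"
    using IVT'[of \<tau> 0 \<beta>hat 1] kappa_less by (metis atLeastAtMost_iff linorder_not_le
        nle_le order_trans zero_le_one less_imp_le)
  then have "\<tau> 1 \<le> \<kappa>" using trapped by simp
  moreover have "W 1 = U (Suc (Suc 0))"
    using multiplier_path_lipschitz[OF W[of 1], of "U (Suc (Suc 0))" "lam (Suc 0)"] multiplier_\<mu>[of "Suc 0"]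
    by (simp add: \<mu>_def)
  ultimately show ?thesis by (simp add: \<tau>_def)
qed

end

section \<open>Convergence under the Lojasiewicz inequality\<close>

text \<open>
  Concavity of \<open>t \<mapsto> t powr (1 - \<alpha>)\<close> in a form without negative exponents, which also covers \<open>y = 0\<close>.
\<close>

lemma powr_diff_ge:
  fixes x y \<alpha> :: real
  assumes "x > 0" "y \<ge> 0" "0 \<le> \<alpha>" "\<alpha> < 1"
  shows "(1 - \<alpha>) * (x - y) \<le> x powr \<alpha> * (x powr (1 - \<alpha>) - y powr (1 - \<alpha>))"
proof -
  have "y powr (1 - \<alpha>) * x powr \<alpha> \<le> (1 - \<alpha>) * y + \<alpha> * x"
    using assms Youngs_inequality_0[of "1 - \<alpha>" \<alpha> y x] by (cases "y = 0") auto
  moreover have "x powr \<alpha> * x powr (1 - \<alpha>) = x"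
    using assms by (simp flip: powr_add)
  ultimately show ?thesis by (simp add: algebra_simps)
qed

text \<open>
  The finite-length argument. As long as the sequence is close to \<open>Z\<close>, twice the next step is at most
  the present step plus a telescoping term; summing, the path is too short to leave the ball,
  so the hypothesis stays in force forever.
\<close>

lemma lojasiewicz_length:
  fixes z :: "nat \<Rightarrow> 'a::metric_space" and \<phi> \<Delta> :: "nat \<Rightarrow> real"
  assumes \<Delta>: "\<And>k. \<Delta> k \<ge> 0" and \<phi>: "\<And>k. \<phi> k \<ge> 0" and "B \<ge> 0" "C \<ge> 0"
    and step: "\<And>k. dist (z (Suc k)) (z k) \<le> C * \<Delta> k"
    and trade: "\<And>k. dist (z (Suc k)) Z \<le> d \<Longrightarrow> 2 * \<Delta> (Suc k) \<le> \<Delta> k + B * (\<phi> (Suc k) - \<phi> (Suc (Suc k)))"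
    and start: "dist (z (Suc N)) Z + C * (\<Delta> N + B * \<phi> (Suc N)) \<le> d"
  shows "summable \<Delta>"
proof -
  let ?S = "\<lambda>n. \<Sum>j<n. \<Delta> (Suc N + j)"
  have bound: "dist (z (Suc N + n)) Z \<le> dist (z (Suc N)) Z + C * ?S n
      \<and> ?S n \<le> \<Delta> N - \<Delta> (N + n) + B * (\<phi> (Suc N) - \<phi> (Suc N + n))" for n
  proof (induction n)
    case (Suc n)
    have "?S n \<le> \<Delta> N + B * \<phi> (Suc N)"
      using Suc.IH \<Delta>[of "N + n"] mult_nonneg_nonneg[OF \<open>B \<ge> 0\<close> \<phi>[of "Suc N + n"]]
      by (simp add: right_diff_distrib)
    then have "C * ?S n \<le> C * (\<Delta> N + B * \<phi> (Suc N))"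
      using \<open>C \<ge> 0\<close> by (rule mult_left_mono)
    then have "dist (z (Suc (N + n))) Z \<le> d"
      using Suc.IH start by simp
    from trade[OF this] have "?S (Suc n) \<le> \<Delta> N - \<Delta> (N + Suc n) + B * (\<phi> (Suc N) - \<phi> (Suc N + Suc n))"
      using Suc.IH by (simp add: right_diff_distrib)
    moreover have "dist (z (Suc N + Suc n)) Z \<le> dist (z (Suc N + n)) Z + C * \<Delta> (Suc N + n)"
      using dist_triangle[of "z (Suc N + Suc n)" Z "z (Suc N + n)"] step[of "Suc N + n"] by simp
    ultimately show ?case using Suc.IH by (simp add: distrib_left)
  qed simp
  have "?S n \<le> \<Delta> N + B * \<phi> (Suc N)" for n
    using bound[of n] \<Delta>[of "N + n"] mult_nonneg_nonneg[OF \<open>B \<ge> 0\<close> \<phi>[of "Suc N + n"]]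
    by (simp add: right_diff_distrib)
  then have "summable (\<lambda>j. \<Delta> (Suc N + j))"
    using \<Delta> by (intro summableI_nonneg_bounded)
  then show ?thesis
    using summable_iff_shift[of \<Delta> "Suc N"] by (simp add: add.commute)
qed

text \<open>
  A bounded descent sequence accumulates at a critical point \<open>Z\<close>. Near \<open>Z\<close> the Lojasiewicz inequality
  bounds the gap \<open>e\<close> in terms of the previous step, and concavity of \<open>e powr (1 - \<alpha>)\<close> trades the
  descent of \<open>F\<close> for length.
\<close>

lemma lojasiewicz_convergence:
  fixes z :: "nat \<Rightarrow> 'a::euclidean_space" and F :: "'a \<Rightarrow> real" and g :: "'a \<Rightarrow> 'b::real_normed_vector"
  assumes bounded: "bounded (range z)"
    and cont_F: "continuous_on UNIV F" and cont_g: "continuous_on UNIV g"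
    and critical: "\<And>Z. g Z = 0 \<Longrightarrow> Z \<in> W"
    and \<alpha>: "0 \<le> \<alpha>" "\<alpha> < 1" and c: "c > 0" "d > 0"
    and KL: "\<And>Z Z'. Z' \<in> W \<Longrightarrow> dist Z Z' \<le> d \<Longrightarrow> \<bar>F Z - F Z'\<bar> powr \<alpha> \<le> c * norm (g Z)"
    and \<Delta>: "\<And>k. \<Delta> k \<ge> 0" and scale: "a > 0" "C \<ge> 0" "K \<ge> 0"
    and descent: "\<And>k. F (z (Suc k)) + a * (\<Delta> k)\<^sup>2 \<le> F (z k)"
    and step: "\<And>k. dist (z (Suc k)) (z k) \<le> C * \<Delta> k"
    and grad: "\<And>k. norm (g (z (Suc k))) \<le> K * \<Delta> k"
  shows "summable \<Delta>" and "\<exists>Z\<in>W. z \<longlonglongrightarrow> Z"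
proof -
  obtain Z r where r: "strict_mono r" and sub: "(z \<circ> r) \<longlonglongrightarrow> Z"
    using bounded_imp_convergent_subsequence[OF bounded] by blast
  have decr: "decseq (\<lambda>k. F (z k))"
    using descent scale by (intro decseq_SucI) (smt (verit) mult_nonneg_nonneg zero_le_power2)
  have sub_F: "(\<lambda>k. F (z (r k))) \<longlonglongrightarrow> F Z"
    using continuous_on_tendsto_compose[OF cont_F sub] by (simp add: comp_def)
  have lower: "F Z \<le> F (z k)" for k
  proof (rule LIMSEQ_le_const2[OF sub_F], intro exI allI impI)
    fix n assume "n \<ge> k"
    then show "F (z (r n)) \<le> F (z k)"
      using decseqD[OF decr] seq_suble[OF r, of n] order_trans by blast
  qed
  have lim_F: "(\<lambda>k. F (z k)) \<longlonglongrightarrow> F Z"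
  proof -
    obtain l where l: "(\<lambda>k. F (z k)) \<longlonglongrightarrow> l"
      using decseq_convergent[OF decr, of "F Z"] lower by blast
    then have "(\<lambda>k. F (z (r k))) \<longlonglongrightarrow> l"
      using LIMSEQ_subseq_LIMSEQ[OF l r] by (simp add: comp_def)
    then show ?thesis using l sub_F LIMSEQ_unique by blast
  qed
  have lim_\<Delta>: "\<Delta> \<longlonglongrightarrow> 0"
  proof -
    have "(\<lambda>k. (F (z k) - F (z (Suc k))) / a) \<longlonglongrightarrow> (F Z - F Z) / a"
      using lim_F LIMSEQ_Suc[OF lim_F] scale by (intro tendsto_intros) auto
    then have lim: "(\<lambda>k. (F (z k) - F (z (Suc k))) / a) \<longlonglongrightarrow> 0" by simp
    have le: "(\<Delta> k)\<^sup>2 \<le> (F (z k) - F (z (Suc k))) / a" for k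
      using descent[of k] scale by (simp add: field_simps)
    have "(\<lambda>k. (\<Delta> k)\<^sup>2) \<longlonglongrightarrow> 0"
      by (rule tendsto_sandwich[OF _ _ tendsto_const lim]) (use le in auto)
    then have "(\<lambda>k. sqrt ((\<Delta> k)\<^sup>2)) \<longlonglongrightarrow> sqrt 0" by (rule tendsto_real_sqrt)
    then show ?thesis using \<Delta> by simp
  qed
  have "(\<lambda>k. K * \<Delta> k) \<longlonglongrightarrow> K * 0" using lim_\<Delta> by (rule tendsto_mult_left)
  then have lim_K: "(\<lambda>k. K * \<Delta> k) \<longlonglongrightarrow> 0" by simp
  have "(\<lambda>k. g (z (Suc k))) \<longlonglongrightarrow> 0"
    by (rule Lim_null_comparison[OF _ lim_K]) (simp add: grad)
  then have "(\<lambda>k. g (z k)) \<longlonglongrightarrow> 0" by (rule LIMSEQ_imp_Suc)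
  then have "(\<lambda>k. g (z (r k))) \<longlonglongrightarrow> 0"
    using LIMSEQ_subseq_LIMSEQ[OF _ r, of "\<lambda>k. g (z k)"] by (simp add: comp_def)
  moreover have "(\<lambda>k. g (z (r k))) \<longlonglongrightarrow> g Z"
    using continuous_on_tendsto_compose[OF cont_g sub] by (simp add: comp_def)
  ultimately have Z: "Z \<in> W" using critical LIMSEQ_unique by blast

  define e where "e k = F (z k) - F Z" for k
  define \<phi> where "\<phi> k = e k powr (1 - \<alpha>)" for k
  define B where "B = c * K / (a * (1 - \<alpha>))"
  have e_nonneg: "e k \<ge> 0" for k using lower by (simp add: e_def)
  have B: "B \<ge> 0" using c scale \<alpha> by (simp add: B_def)
  have \<phi>_nonneg: "\<phi> k \<ge> 0" for k by (simp add: \<phi>_def)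
  have trade: "2 * \<Delta> (Suc k) \<le> \<Delta> k + B * (\<phi> (Suc k) - \<phi> (Suc (Suc k)))"
    if near: "dist (z (Suc k)) Z \<le> d" for k
  proof -
    let ?e = "e (Suc k)" and ?e' = "e (Suc (Suc k))"
    have drop: "a * (\<Delta> (Suc k))\<^sup>2 \<le> ?e - ?e'"
      using descent[of "Suc k"] by (simp add: e_def)
    show ?thesis
    proof (cases "?e = 0")
      case True
      then have "a * (\<Delta> (Suc k))\<^sup>2 \<le> 0" "?e' = 0"
        using drop e_nonneg[of "Suc (Suc k)"] scale(1)
        by (smt (verit) mult_nonneg_nonneg zero_le_power2)+
      then have "\<Delta> (Suc k) = 0" using scale(1) by (simp add: mult_le_0_iff)
      then show ?thesis using True \<open>?e' = 0\<close> \<Delta>[of k] by (simp add: \<phi>_def)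
    next
      case False
      then have pos: "?e > 0" using e_nonneg[of "Suc k"] by simp
      let ?D = "\<phi> (Suc k) - \<phi> (Suc (Suc k))"
      have "?e' \<le> ?e" using drop scale(1) by (smt (verit) mult_nonneg_nonneg zero_le_power2)
      then have D: "?D \<ge> 0"
        unfolding \<phi>_def using e_nonneg \<alpha> by (simp add: powr_mono2)
      have "?e powr \<alpha> \<le> c * norm (g (z (Suc k)))"
        using KL[OF Z near] e_nonneg[of "Suc k"] by (simp add: e_def)
      also have "\<dots> \<le> c * (K * \<Delta> k)" using grad c by (intro mult_left_mono) auto
      finally have kl: "?e powr \<alpha> \<le> c * (K * \<Delta> k)" .
      have "(1 - \<alpha>) * (?e - ?e') \<le> ?e powr \<alpha> * ?D"
        unfolding \<phi>_def by (rule powr_diff_ge[OF pos e_nonneg \<alpha>])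
      also have "\<dots> \<le> c * (K * \<Delta> k) * ?D" using kl D by (rule mult_right_mono)
      finally have "(1 - \<alpha>) * (?e - ?e') \<le> c * (K * \<Delta> k) * ?D" .
      moreover have "(1 - \<alpha>) * (a * (\<Delta> (Suc k))\<^sup>2) \<le> (1 - \<alpha>) * (?e - ?e')"
        using drop \<alpha> by (intro mult_left_mono) auto
      ultimately have "(1 - \<alpha>) * (a * (\<Delta> (Suc k))\<^sup>2) \<le> c * (K * \<Delta> k) * ?D" by simp
      then have "(\<Delta> (Suc k))\<^sup>2 \<le> \<Delta> k * (B * ?D)"
        using scale(1) \<alpha> by (simp add: B_def field_simps)
      \<comment> \<open>Arithmetic-geometric mean: \<open>4 x y \<le> (x + y)\<^sup>2\<close> with \<open>x = \<Delta> k\<close> and \<open>y = B * ?D\<close>.\<close>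
      moreover have "0 \<le> (\<Delta> k - B * ?D)\<^sup>2" by simp
      ultimately have "(2 * \<Delta> (Suc k))\<^sup>2 \<le> (\<Delta> k + B * ?D)\<^sup>2"
        by (simp add: power2_eq_square algebra_simps)
      then show ?thesis by (rule power2_le_imp_le) (use \<Delta> B D in simp)
    qed
  qed
  have "\<exists>N. dist (z (Suc N)) Z + C * (\<Delta> N + B * \<phi> (Suc N)) \<le> d"
  proof -
    have "(\<lambda>k. e (Suc k)) \<longlonglongrightarrow> F Z - F Z"
      unfolding e_def using LIMSEQ_Suc[OF lim_F] by (intro tendsto_intros)
    then have "(\<lambda>k. \<phi> (Suc k)) \<longlonglongrightarrow> 0 powr (1 - \<alpha>)"
      unfolding \<phi>_def using \<alpha> e_nonneg by (intro tendsto_powr' tendsto_intros) auto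
    then have "(\<lambda>k. C * (\<Delta> k + B * \<phi> (Suc k))) \<longlonglongrightarrow> C * (0 + B * 0)"
      using lim_\<Delta> by (intro tendsto_intros) auto
    then have "\<forall>\<^sub>F k in sequentially. C * (\<Delta> k + B * \<phi> (Suc k)) < d / 2"
      using c by (intro order_tendstoD(2)) auto
    then obtain M where M: "\<And>k. k \<ge> M \<Longrightarrow> C * (\<Delta> k + B * \<phi> (Suc k)) < d / 2"
      by (auto simp: eventually_sequentially)
    obtain M' where M': "\<And>k. k \<ge> M' \<Longrightarrow> dist (z (r k)) Z < d / 2"
      using sub c unfolding lim_sequentially comp_def by (meson half_gt_zero)
    let ?k = "max M' (Suc M)"
    have "r ?k \<ge> Suc M" using seq_suble[OF r, of ?k] by simp
    then obtain N where N: "r ?k = Suc N" "N \<ge> M" by (cases "r ?k") auto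
    then show ?thesis using M[OF N(2)] M'[of ?k] by (intro exI[of _ N]) auto
  qed
  then obtain N where "dist (z (Suc N)) Z + C * (\<Delta> N + B * \<phi> (Suc N)) \<le> d" by blast
  from lojasiewicz_length[OF \<Delta> \<phi>_nonneg B scale(2) step trade this]
  show summable: "summable \<Delta>" .
  have "summable (\<lambda>k. z (Suc k) - z k)"
    by (rule summable_comparison_test'[where N = 0, OF summable_mult[OF summable, of C]])
      (use step in \<open>simp add: dist_norm\<close>)
  then have "(\<lambda>n. z 0 + (\<Sum>k<n. z (Suc k) - z k)) \<longlonglongrightarrow> z 0 + (\<Sum>k. z (Suc k) - z k)"
    by (intro tendsto_intros summable_LIMSEQ)
  then obtain Z' where "z \<longlonglongrightarrow> Z'" by (auto simp: sum_lessThan_telescope)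
  moreover have "Z' = Z"
    using LIMSEQ_subseq_LIMSEQ[OF \<open>z \<longlonglongrightarrow> Z'\<close> r] sub LIMSEQ_unique by blast
  ultimately show "\<exists>Z\<in>W. z \<longlonglongrightarrow> Z" using Z by blast
qed

text \<open>
  The smallest of the first \<open>n\<close> terms is at most their average. This is where the rate \<open>1/\<epsilon>\<close> comes
  from: the path has finite length.
\<close>

lemma summable_imp_small_term:
  fixes \<Delta> :: "nat \<Rightarrow> real"
  assumes "summable \<Delta>" "\<And>k. \<Delta> k \<ge> 0"
  shows "\<exists>S\<ge>0. \<forall>n::nat. n > 0 \<longrightarrow> (\<exists>k<n. \<Delta> k \<le> S / real n)"
proof (rule exI[of _ "suminf \<Delta>"], intro conjI allI impI)
  show "suminf \<Delta> \<ge> 0" using assms by (rule suminf_nonneg)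
  fix n :: nat assume n: "n > 0"
  show "\<exists>k<n. \<Delta> k \<le> suminf \<Delta> / real n"
  proof (rule ccontr)
    assume "\<not> (\<exists>k<n. \<Delta> k \<le> suminf \<Delta> / real n)"
    then have "(\<Sum>k<n. suminf \<Delta> / real n) < (\<Sum>k<n. \<Delta> k)"
      using n by (intro sum_strict_mono) (auto simp: not_le)
    also have "\<dots> \<le> suminf \<Delta>" using assms by (intro sum_le_suminf) auto
    finally show False using n by simp
  qed
qed

context admm_run
begin

section \<open>The iterates stay in the regular region\<close>

text \<open>
  The trapping argument along the segment from the old to the new \<open>U\<close>, each point of which is
  judged with its best partner.
\<close>

lemma U_trapped:
  assumes start: "\<exists>Y. T (U (Suc k)) Y \<le> \<kappa>" and G: "V (Suc k) \<in> G"
    and le: "AL (U (Suc k)) (V (Suc k)) (lam (Suc k)) \<le> \<kappa>"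
  shows "\<exists>Y. T (U (Suc (Suc k))) Y \<le> \<kappa>"
proof -
  let ?u = "\<lambda>s. U (Suc k) + s *\<^sub>R (U (Suc (Suc k)) - U (Suc k))"
  have "\<exists>Y. T (?u 1) Y \<le> \<kappa>"
  proof (rule minimum_continuation[of T \<beta>hat ?u \<kappa>])
    show "continuous_on UNIV (\<lambda>z. T (fst z :: real^'r^'n) (snd z))"
      by (intro continuous_intros)
    show "continuous_on {0..1} ?u" by (intro continuous_intros)
    fix s Y assume s: "s \<in> {0..1}" and min: "\<And>Y'. T (?u s) Y \<le> T (?u s) Y'"
      and Y: "T (?u s) Y \<le> \<beta>hat"
    have "U (Suc k) \<in> G" using start in_G_kappa by blast
    moreover have "AL (?u s) (V (Suc k)) (lam (Suc k)) \<le> \<kappa> - \<gamma> / 2 * (norm (?u s - U (Suc k)))\<^sup>2"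
      using U_descent_segment[OF s, of "Suc k"] le by linarith
    ultimately show "T (?u s) Y \<le> \<kappa>"
      using T_after_U_step[OF multiplier_lam] G min Y by blast
  qed (use start compact_T kappa_less in auto)
  then show ?thesis by simp
qed

lemma V_trapped:
  assumes start: "\<exists>X. T X (V k) \<le> \<kappa>" and G: "U (Suc k) \<in> G"
    and le: "energy (U (Suc k)) (V k) (lam k) (\<mu> k) \<le> \<kappa>"
  shows "\<exists>X. T X (V (Suc k)) \<le> \<kappa>"
proof -
  let ?v = "\<lambda>s. V k + s *\<^sub>R (V (Suc k) - V k)"
  have "\<exists>X. T X (?v 1) \<le> \<kappa>"
  proof (rule minimum_continuation[of "\<lambda>Y X. T X Y" \<beta>hat ?v \<kappa>])
    show "continuous_on UNIV (\<lambda>z. T (snd z :: real^'r^'n) (fst z))"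
      by (intro continuous_intros)
    show "compact {(Y :: real^'r^'n, X). T X Y \<le> \<beta>hat}"
      using compact_T by (simp add: T_commute)
    show "continuous_on {0..1} ?v" by (intro continuous_intros)
    fix s X assume s: "s \<in> {0..1}" and min: "\<And>X'. T X (?v s) \<le> T X' (?v s)"
      and X: "T X (?v s) \<le> \<beta>hat"
    have "V k \<in> G" using start in_G_kappa by blast
    moreover have "AL (U (Suc k)) (?v s) (lam k)
        \<le> AL (U (Suc k)) (V k) (lam k) - \<gamma> / 2 * (norm (?v s - V k))\<^sup>2"
      using V_descent_segment[OF s, of k] by linarith
    ultimately have "T X (?v s) \<le> energy (U (Suc k)) (V k) (lam k) (\<mu> k)"
      using T_after_V_step[of "V k" "U (Suc k)" "lam k" "?v s" X] multiplier_\<mu>[of k] G min X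
      by (simp add: \<mu>_def)
    then show "T X (?v s) \<le> \<kappa>" using le by simp
  qed (use start kappa_less in auto)
  then show ?thesis by simp
qed

text \<open>
  Two applications of strong convexity give two cost terms, which together pay for the change
  \<open>u - m\<close> of the \<open>U\<close>-type multiplier. The remaining quadratic form in the four consecutive
  multipliers \<open>l, m, c, u\<close> is minus a sum of two squares; the form of the energy is chosen for this.
\<close>

lemma energy_decreasing:
  assumes "U (Suc k) \<in> G" "V k \<in> G" "U (Suc (Suc k)) \<in> G" "V (Suc k) \<in> G"
  shows "energy (U (Suc (Suc k))) (V (Suc k)) (lam (Suc k)) (\<mu> (Suc k))
    \<le> energy (U (Suc k)) (V k) (lam k) (\<mu> k)"
proof -
  define l m c u where "l = lam k" and "m = \<mu> k" and "c = lam (Suc k)" and "u = \<mu> (Suc k)"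
  have "D (U (Suc k)) (V (Suc k)) + \<gamma> / 2 * (norm (V k - V (Suc k)))\<^sup>2
      \<le> D (U (Suc k)) (V k) + c \<bullet> (m - c) / \<rho>"
    using multiplier_growth[OF multiplier_lam[of k], of "V k"]
    by (simp add: res_U_step res_V_step l_def m_def c_def inner_diff_right diff_divide_distrib)
  moreover have "D (U (Suc (Suc k))) (V (Suc k)) + \<gamma> / 2 * (norm (U (Suc k) - U (Suc (Suc k))))\<^sup>2
      \<le> D (U (Suc k)) (V (Suc k)) + u \<bullet> (2 *\<^sub>R c - l - u) / \<rho>"
    using multiplier_growth[OF multiplier_\<mu>[of "Suc k"], of "U (Suc k)"]
    by (simp add: D_commute[of "V (Suc k)"] res_commute[of "V (Suc k)"] res_U_step[of "Suc k"]
        res_V_step l_def u_def c_def inner_diff_right diff_divide_distrib)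
  moreover have "(norm (m - u))\<^sup>2 / \<rho> \<le> \<gamma> / 2 * (norm (V k - V (Suc k)))\<^sup>2
      + \<gamma> / 2 * (norm (U (Suc k) - U (Suc (Suc k))))\<^sup>2"
    unfolding m_def u_def by (intro multiplier_step_le multiplier_\<mu> assms)
  ultimately have "energy (U (Suc (Suc k))) (V (Suc k)) c u
      \<le> energy (U (Suc k)) (V k) l m + (c \<bullet> (m - c) + u \<bullet> (2 *\<^sub>R c - l - u) - (norm (m - u))\<^sup>2
        + (3 / 2 * (norm u)\<^sup>2 - 2 * (u \<bullet> c) + (norm c)\<^sup>2 / 2)
        - (3 / 2 * (norm m)\<^sup>2 - 2 * (m \<bullet> l) + (norm l)\<^sup>2 / 2)) / \<rho>"
    unfolding energy_def add_divide_distrib diff_divide_distrib by linarith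
  also have "c \<bullet> (m - c) + u \<bullet> (2 *\<^sub>R c - l - u) - (norm (m - u))\<^sup>2
        + (3 / 2 * (norm u)\<^sup>2 - 2 * (u \<bullet> c) + (norm c)\<^sup>2 / 2)
        - (3 / 2 * (norm m)\<^sup>2 - 2 * (m \<bullet> l) + (norm l)\<^sup>2 / 2)
      = - ((norm (c - m))\<^sup>2 + (norm (u - 2 *\<^sub>R m + l))\<^sup>2) / 2"
    unfolding power2_norm_eq_inner
    by (simp add: inner_diff_left inner_diff_right inner_add_left inner_add_right inner_commute
        field_simps)
  finally have "energy (U (Suc (Suc k))) (V (Suc k)) c u
      \<le> energy (U (Suc k)) (V k) l m + - ((norm (c - m))\<^sup>2 + (norm (u - 2 *\<^sub>R m + l))\<^sup>2) / 2 / \<rho>" .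
  moreover have "- ((norm (c - m))\<^sup>2 + (norm (u - 2 *\<^sub>R m + l))\<^sup>2) / 2 / \<rho> \<le> 0"
    using rho_pos sum_power2_ge_zero[of "norm (c - m)" "norm (u - 2 *\<^sub>R m + l)"]
    by (intro divide_nonpos_pos) linarith+
  ultimately show ?thesis unfolding l_def m_def c_def u_def by linarith
qed

text \<open>
  The increase of the augmented Lagrangian in the dual step is paid for by the two primal steps.
\<close>

lemma lagrangian_step:
  assumes "U (Suc k) \<in> G" "V (Suc k) \<in> G" "U (Suc (Suc k)) \<in> G" "V (Suc (Suc k)) \<in> G"
  shows "AL (U (Suc (Suc k))) (V (Suc (Suc k))) (lam (Suc (Suc k)))
      \<le> AL (U (Suc (Suc k))) (V (Suc k)) (lam (Suc k))
        + \<gamma> / 2 * (norm (U (Suc (Suc k)) - U (Suc k)))\<^sup>2"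
proof -
  have "(norm (lam (Suc (Suc k)) - lam (Suc k)))\<^sup>2 / \<rho>
      \<le> \<gamma> / 2 * (norm (U (Suc (Suc k)) - U (Suc k)))\<^sup>2 + \<gamma> / 2 * (norm (V (Suc (Suc k)) - V (Suc k)))\<^sup>2"
    by (intro multiplier_step_le multiplier_lam assms)
  then show ?thesis using V_descent[of "Suc k"] dual_step[of "Suc k"] by linarith
qed

text \<open>
  The invariant. The energy certifies the next \<open>V\<close>, the augmented Lagrangian the next \<open>U\<close>. Both
  potentials start at or below \<open>\<kappa>\<close> because \<open>U 2\<close> was certified directly and its multiplier is bounded by
  \<open>\<Lambda>\<close>.
\<close>

lemma trapped:
  "U (Suc k) \<in> G \<and> (\<exists>Y. T (U (Suc (Suc k))) Y \<le> \<kappa>) \<and> (\<exists>X. T X (V (Suc k)) \<le> \<kappa>)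
    \<and> energy (U (Suc (Suc k))) (V (Suc k)) (lam (Suc k)) (\<mu> (Suc k)) \<le> \<kappa>
    \<and> AL (U (Suc (Suc k))) (V (Suc k)) (lam (Suc k))
      + \<gamma> / 2 * (norm (U (Suc (Suc k)) - U (Suc k)))\<^sup>2 \<le> \<kappa>"
proof (induction k)
  case 0
  define a c m where "a = lam 0" and "c = lam (Suc 0)" and "m = \<mu> (Suc 0)"
  have G: "U (Suc (Suc 0)) \<in> G" using second_U_level in_G_kappa by blast
  then have "norm m \<le> \<Lambda>"
    unfolding m_def using norm_multiplier_le[OF multiplier_\<mu>] first_in_G by blast
  then have m: "(norm m)\<^sup>2 \<le> \<Lambda>\<^sup>2" by (intro power_mono) auto
  let ?cost = "\<gamma> / 2 * (norm (U (Suc (Suc 0)) - U (Suc 0)))\<^sup>2"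
  have cost: "0 \<le> ?cost" using gamma_pos by simp
  have D: "D (U (Suc (Suc 0))) (V (Suc 0)) + ?cost
      \<le> \<beta>\<^sub>0 + (- (norm a)\<^sup>2 / 2 - (norm c)\<^sup>2 / 2 + m \<bullet> (2 *\<^sub>R c - a - m)) / \<rho>"
    using first_path_bound(1)[OF multiplier_\<mu>[of "Suc 0"], of 1] by (simp add: \<mu>_def a_def c_def m_def)
  have "energy (U (Suc (Suc 0))) (V (Suc 0)) c m
      \<le> \<beta>\<^sub>0 + (- (norm a)\<^sup>2 / 2 - (norm c)\<^sup>2 / 2 + m \<bullet> (2 *\<^sub>R c - a - m)
        + (3 / 2 * (norm m)\<^sup>2 - 2 * (m \<bullet> c) + (norm c)\<^sup>2 / 2)) / \<rho>"
    using D cost unfolding energy_def add_divide_distrib by linarith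
  moreover have "- (norm a)\<^sup>2 / 2 - (norm c)\<^sup>2 / 2 + m \<bullet> (2 *\<^sub>R c - a - m)
        + (3 / 2 * (norm m)\<^sup>2 - 2 * (m \<bullet> c) + (norm c)\<^sup>2 / 2) = (norm m)\<^sup>2 - (norm (a + m))\<^sup>2 / 2"
    unfolding power2_norm_eq_inner
    by (simp add: inner_diff_right inner_add_left inner_add_right inner_commute field_simps)
  moreover have "(norm m)\<^sup>2 - (norm (a + m))\<^sup>2 / 2 \<le> \<Lambda>\<^sup>2"
    using m zero_le_power2[of "norm (a + m)"] by linarith
  ultimately have energy: "energy (U (Suc (Suc 0))) (V (Suc 0)) c m \<le> \<kappa>"
    using le_kappa by metis
  have "AL (U (Suc (Suc 0))) (V (Suc 0)) c = D (U (Suc (Suc 0))) (V (Suc 0))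
      + ((norm m)\<^sup>2 / 2 - (norm c)\<^sup>2 / 2) / \<rho>"
    by (simp add: AL_eq m_def c_def \<mu>_def diff_divide_distrib)
  then have "AL (U (Suc (Suc 0))) (V (Suc 0)) c + ?cost
      \<le> \<beta>\<^sub>0 + (- (norm a)\<^sup>2 / 2 - (norm c)\<^sup>2 / 2 + m \<bullet> (2 *\<^sub>R c - a - m)
        + ((norm m)\<^sup>2 / 2 - (norm c)\<^sup>2 / 2)) / \<rho>"
    using D unfolding add_divide_distrib by linarith
  moreover have "- (norm a)\<^sup>2 / 2 - (norm c)\<^sup>2 / 2 + m \<bullet> (2 *\<^sub>R c - a - m)
        + ((norm m)\<^sup>2 / 2 - (norm c)\<^sup>2 / 2)
      = (norm m)\<^sup>2 - (norm (a + m))\<^sup>2 / 2 - (norm (c - m))\<^sup>2"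
    unfolding power2_norm_eq_inner
    by (simp add: inner_diff_left inner_diff_right inner_add_left inner_add_right inner_commute
        field_simps)
  moreover have "(norm m)\<^sup>2 - (norm (a + m))\<^sup>2 / 2 - (norm (c - m))\<^sup>2 \<le> \<Lambda>\<^sup>2"
    using m zero_le_power2[of "norm (a + m)"] zero_le_power2[of "norm (c - m)"] by linarith
  ultimately have "AL (U (Suc (Suc 0))) (V (Suc 0)) c + ?cost \<le> \<kappa>"
    using le_kappa by metis
  moreover have "\<exists>X. T X (V (Suc 0)) \<le> \<kappa>"
    using first_V_level level0_le_kappa order_trans by blast
  ultimately show ?case
    using second_U_level energy first_in_G unfolding c_def m_def by blast
next
  case (Suc k)
  have U1: "U (Suc k) \<in> G" and V1: "V (Suc k) \<in> G" and U2: "U (Suc (Suc k)) \<in> G"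
    using Suc.IH in_G_kappa by blast+
  have V2: "\<exists>X. T X (V (Suc (Suc k))) \<le> \<kappa>"
    using V_trapped[of "Suc k"] Suc.IH U2 by blast
  then have V2G: "V (Suc (Suc k)) \<in> G" using in_G_kappa by blast
  have AL2: "AL (U (Suc (Suc k))) (V (Suc (Suc k))) (lam (Suc (Suc k))) \<le> \<kappa>"
    using lagrangian_step[OF U1 V1 U2 V2G] Suc.IH by linarith
  have U3: "\<exists>Y. T (U (Suc (Suc (Suc k)))) Y \<le> \<kappa>"
    using U_trapped[of "Suc k"] Suc.IH V2G AL2 by blast
  then have "U (Suc (Suc (Suc k))) \<in> G" using in_G_kappa by blast
  then have "energy (U (Suc (Suc (Suc k)))) (V (Suc (Suc k))) (lam (Suc (Suc k))) (\<mu> (Suc (Suc k))) \<le> \<kappa>"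
    using energy_decreasing[of "Suc k"] U2 V1 V2G Suc.IH by fastforce
  then show ?case
    using U2 U3 V2 U_descent[of "Suc (Suc k)"] AL2 by auto
qed

lemma U_in_G: "U (Suc k) \<in> G" and V_in_G: "V (Suc k) \<in> G"
  using trapped in_G_kappa by blast+

section \<open>Convergence of the iterates\<close>

definition step_len :: "nat \<Rightarrow> real" where
  "step_len k = norm (U (Suc k) - U k) + norm (V (Suc k) - V k)"

lemma step_len_nonneg: "step_len k \<ge> 0"
  by (simp add: step_len_def)

lemma norm_lam_le: "norm (lam (Suc k)) \<le> \<Lambda>"
  by (rule norm_multiplier_le[OF multiplier_lam U_in_G V_in_G])

lemma norm_lam_step_le:
  "norm (lam (Suc (Suc k)) - lam (Suc k)) \<le> sqrt (\<rho> * \<gamma> / 2) * step_len (Suc k)"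
proof -
  let ?u = "norm (U (Suc (Suc k)) - U (Suc k))" and ?v = "norm (V (Suc (Suc k)) - V (Suc k))"
  have "(norm (lam (Suc (Suc k)) - lam (Suc k)))\<^sup>2 / \<rho> \<le> \<gamma> / 2 * ?u\<^sup>2 + \<gamma> / 2 * ?v\<^sup>2"
    by (intro multiplier_step_le multiplier_lam U_in_G V_in_G)
  also have "\<dots> \<le> \<gamma> / 2 * (?u + ?v)\<^sup>2"
    using gamma_pos by (simp add: power2_sum distrib_left)
  finally have "(norm (lam (Suc (Suc k)) - lam (Suc k)))\<^sup>2 \<le> \<rho> * \<gamma> / 2 * (?u + ?v)\<^sup>2"
    using rho_pos by (simp add: field_simps)
  also have "\<dots> = (sqrt (\<rho> * \<gamma> / 2) * (?u + ?v))\<^sup>2"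
    using rho_pos gamma_pos by (simp add: power_mult_distrib)
  finally have "(norm (lam (Suc (Suc k)) - lam (Suc k)))\<^sup>2 \<le> (sqrt (\<rho> * \<gamma> / 2) * (?u + ?v))\<^sup>2" .
  then show ?thesis
    unfolding step_len_def by (rule power2_le_imp_le) (use rho_pos gamma_pos in simp)
qed

text \<open>
  The strict inequalities on \<open>\<rho>\<close> leave a positive fraction of the primal descent.
\<close>

lemma sufficient_descent:
  "\<exists>a>0. \<forall>k. AL (U (Suc (Suc k))) (V (Suc (Suc k))) (lam (Suc (Suc k))) + a * (step_len (Suc k))\<^sup>2
    \<le> AL (U (Suc k)) (V (Suc k)) (lam (Suc k))"
proof -
  define a where "a = min (\<gamma> / 2 - c1 / \<rho>) (\<gamma> / 2 - c2 / \<rho>)"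
  have "a > 0" using c1_less c2_less rho_pos by (simp add: a_def field_simps)
  moreover have "AL (U (Suc (Suc k))) (V (Suc (Suc k))) (lam (Suc (Suc k))) + a / 2 * (step_len (Suc k))\<^sup>2
    \<le> AL (U (Suc k)) (V (Suc k)) (lam (Suc k))" for k
  proof -
    let ?u = "norm (U (Suc (Suc k)) - U (Suc k))" and ?v = "norm (V (Suc (Suc k)) - V (Suc k))"
    have "(norm (lam (Suc (Suc k)) - lam (Suc k)))\<^sup>2 \<le> c1 * ?u\<^sup>2 + c2 * ?v\<^sup>2"
      by (intro multiplier_lipschitz multiplier_lam U_in_G V_in_G)
    then have "(norm (lam (Suc (Suc k)) - lam (Suc k)))\<^sup>2 / \<rho> \<le> c1 / \<rho> * ?u\<^sup>2 + c2 / \<rho> * ?v\<^sup>2"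
      using rho_pos by (simp add: field_simps)
    moreover have "a * ?u\<^sup>2 \<le> (\<gamma> / 2 - c1 / \<rho>) * ?u\<^sup>2" "a * ?v\<^sup>2 \<le> (\<gamma> / 2 - c2 / \<rho>) * ?v\<^sup>2"
      by (intro mult_right_mono; simp add: a_def)+
    moreover have "a / 2 * (step_len (Suc k))\<^sup>2 \<le> a * ?u\<^sup>2 + a * ?v\<^sup>2"
      using mult_left_mono[OF sum_squares_bound[of ?u ?v], of "a / 2"] \<open>a > 0\<close>
      by (simp add: step_len_def power2_sum algebra_simps)
    ultimately show ?thesis
      using U_descent[of "Suc k"] V_descent[of "Suc k"] dual_step[of "Suc k"]
      by (simp add: left_diff_distrib)
  qed
  ultimately show ?thesis by (intro exI[of _ "a / 2"]) auto
qed

text \<open>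
  The minimization in \<open>U\<close> makes the residual vanish at the previous \<open>V\<close> with multiplier \<open>\<mu>\<close>; replacing
  \<open>V\<close> and \<open>\<mu>\<close> by the new \<open>V\<close> and the new dual variable changes it by a multiple of the step in \<open>V\<close>.
\<close>

lemma U_residual_le:
  "\<exists>K\<ge>0. \<forall>k. norm (gradient f (U (Suc (Suc k)) ** transpose (V (Suc (Suc k)))) ** V (Suc (Suc k))
      + \<gamma> *\<^sub>R (U (Suc (Suc k)) - V (Suc (Suc k))) + adj (lam (Suc (Suc k))) ** V (Suc (Suc k)))
    \<le> K * step_len (Suc k)"
proof -
  let ?s = "sqrt (\<Sum>i\<in>UNIV. (norm (A i))\<^sup>2)"
  have s: "?s \<ge> 0" by (simp add: sum_nonneg)
  define K where "K = L * \<delta> * \<delta> + Lf + \<gamma> + ?s * (\<rho> * (?s * \<delta>)) * \<delta> + ?s * \<Lambda>"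
  have K: "K \<ge> 0"
    using s L_nonneg Lf_nonneg gamma_pos rho_pos delta_pos Lambda_nonneg by (simp add: K_def)
  show ?thesis
  proof (intro exI[of _ K] conjI allI K)
    fix k
    define u v v' l m where "u = U (Suc (Suc k))" and "v = V (Suc k)" and "v' = V (Suc (Suc k))"
      and "l = lam (Suc (Suc k))" and "m = \<mu> (Suc k)"
    let ?d = "norm (v' - v)"
    have G: "u \<in> G" "v \<in> G" "v' \<in> G"
      unfolding u_def v_def v'_def by (rule U_in_G V_in_G)+
    have \<mu>: "multiplier v u m" unfolding u_def v_def m_def by (rule multiplier_\<mu>)
    \<comment> \<open>Both variables arise from \<open>lam (Suc k)\<close>, with residuals at the old and at the new \<open>V\<close>.\<close>
    have lm: "l - m = \<rho> *\<^sub>R lin_op A (u ** transpose (v' - v))"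
      by (simp add: l_def m_def u_def v'_def v_def \<mu>_def lam_step[of "Suc k"] res_def
          transpose_diff matrix_mult_diff_right lin_op_diff algebra_simps)
    have "gradient f (u ** transpose v') ** v' + \<gamma> *\<^sub>R (u - v') + adj l ** v'
        = (gradient f (u ** transpose v') - gradient f (u ** transpose v)) ** v'
          + gradient f (u ** transpose v) ** (v' - v) - \<gamma> *\<^sub>R (v' - v) + adj (l - m) ** v'
          + adj m ** (v' - v)
          + (gradient f (u ** transpose v) ** v + \<gamma> *\<^sub>R (u - v) + adj m ** v)"
      by (simp add: matrix_mult_diff_left matrix_mult_diff_right adj_diff algebra_simps)
    also have "gradient f (u ** transpose v) ** v + \<gamma> *\<^sub>R (u - v) + adj m ** v = 0"
      using \<mu> by (simp add: multiplier_def)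
    finally have eq: "gradient f (u ** transpose v') ** v' + \<gamma> *\<^sub>R (u - v') + adj l ** v'
        = (gradient f (u ** transpose v') - gradient f (u ** transpose v)) ** v'
          + gradient f (u ** transpose v) ** (v' - v) - \<gamma> *\<^sub>R (v' - v) + adj (l - m) ** v'
          + adj m ** (v' - v)" by simp
    have "norm (u ** transpose v' - u ** transpose v) \<le> \<delta> * (norm (u - u) + ?d)"
      by (intro norm_outer_diff_le norm_le_delta G)
    then have "norm (gradient f (u ** transpose v') - gradient f (u ** transpose v)) \<le> L * (\<delta> * ?d)"
      by (intro order_trans[OF gradient_lipschitz] mult_left_mono norm_outer_le G L_nonneg) simp
    then have 1: "norm ((gradient f (u ** transpose v') - gradient f (u ** transpose v)) ** v')
        \<le> L * (\<delta> * ?d) * \<delta>"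
      using norm_le_delta[OF G(3)] L_nonneg delta_pos
      by (intro order_trans[OF norm_matrix_mult_le] mult_mono) auto
    have 2: "norm (gradient f (u ** transpose v) ** (v' - v)) \<le> Lf * ?d"
      by (intro order_trans[OF norm_matrix_mult_le] mult_right_mono norm_gradient_le norm_outer_le G)
        auto
    have 3: "norm (\<gamma> *\<^sub>R (v' - v)) \<le> \<gamma> * ?d" using gamma_pos by simp
    have "norm (u ** transpose (v' - v)) \<le> \<delta> * ?d"
      by (intro order_trans[OF norm_matrix_mult_le])
        (simp add: norm_transpose mult_right_mono norm_le_delta G)
    then have "norm (lin_op A (u ** transpose (v' - v))) \<le> ?s * (\<delta> * ?d)"
      by (intro order_trans[OF norm_lin_op_le] mult_left_mono s)
    then have "norm (l - m) \<le> \<rho> * (?s * (\<delta> * ?d))"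
      using rho_pos by (simp add: lm)
    then have "norm (adj (l - m)) \<le> ?s * (\<rho> * (?s * (\<delta> * ?d)))"
      by (intro order_trans[OF norm_adj_le] mult_left_mono s)
    then have 4: "norm (adj (l - m) ** v') \<le> ?s * (\<rho> * (?s * (\<delta> * ?d))) * \<delta>"
      using norm_le_delta[OF G(3)] s rho_pos delta_pos
      by (intro order_trans[OF norm_matrix_mult_le] mult_mono) auto
    have 5: "norm (adj m ** (v' - v)) \<le> ?s * \<Lambda> * ?d"
      by (intro order_trans[OF norm_matrix_mult_le] mult_right_mono order_trans[OF norm_adj_le]
          mult_left_mono norm_multiplier_le[OF \<mu>] s G) auto
    have "norm (gradient f (u ** transpose v') ** v' + \<gamma> *\<^sub>R (u - v') + adj l ** v')
        \<le> L * (\<delta> * ?d) * \<delta> + Lf * ?d + \<gamma> * ?d + ?s * (\<rho> * (?s * (\<delta> * ?d))) * \<delta> + ?s * \<Lambda> * ?d"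
      unfolding eq
      by (intro norm_triangle_le add_mono norm_triangle_le_diff 1 2 3 4 5)
    also have "\<dots> = K * ?d" by (simp add: K_def algebra_simps)
    also have "\<dots> \<le> K * step_len (Suc k)"
      using K by (intro mult_left_mono) (simp_all add: step_len_def v_def v'_def)
    finally show "norm (gradient f (U (Suc (Suc k)) ** transpose (V (Suc (Suc k)))) ** V (Suc (Suc k))
      + \<gamma> *\<^sub>R (U (Suc (Suc k)) - V (Suc (Suc k))) + adj (lam (Suc (Suc k))) ** V (Suc (Suc k)))
      \<le> K * step_len (Suc k)"
      by (simp add: u_def v'_def l_def)
  qed
qed

lemma V_residual_zero:
  "gradient f (V (Suc k) ** transpose (U (Suc k))) ** U (Suc k)
    + \<gamma> *\<^sub>R (V (Suc k) - U (Suc k)) + adj (lam (Suc k)) ** U (Suc k) = 0"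
  using multiplier_lam by (simp add: multiplier_def)

lemma norm_res_le:
  "norm (res (U (Suc (Suc k))) (V (Suc (Suc k)))) \<le> sqrt (\<rho> * \<gamma> / 2) / \<rho> * step_len (Suc k)"
  using norm_lam_step_le[of k] rho_pos unfolding res_V_step norm_scaleR by (simp add: field_simps)

lemma eps_kkt_le:
  "\<exists>K\<ge>0. \<forall>k. eps_kkt f A b \<gamma> (K * step_len (Suc k))
    (U (Suc (Suc k)), V (Suc (Suc k)), lam (Suc (Suc k)))"
proof -
  obtain K where K: "K \<ge> 0" and le: "\<And>k. norm (gradient f (U (Suc (Suc k)) ** transpose (V (Suc (Suc k)))) ** V (Suc (Suc k))
      + \<gamma> *\<^sub>R (U (Suc (Suc k)) - V (Suc (Suc k))) + adj (lam (Suc (Suc k))) ** V (Suc (Suc k)))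
    \<le> K * step_len (Suc k)"
    using U_residual_le by blast
  let ?H = "sqrt (\<rho> * \<gamma> / 2) / \<rho>"
  have H: "?H \<ge> 0" using rho_pos gamma_pos by simp
  have "eps_kkt f A b \<gamma> ((K + ?H) * step_len (Suc k))
      (U (Suc (Suc k)), V (Suc (Suc k)), lam (Suc (Suc k)))" for k
  proof -
    have "K * step_len (Suc k) \<le> (K + ?H) * step_len (Suc k)"
      by (rule mult_right_mono) (use H step_len_nonneg in auto)
    moreover have "?H * step_len (Suc k) \<le> (K + ?H) * step_len (Suc k)"
      by (rule mult_right_mono) (use K step_len_nonneg in auto)
    moreover have "0 \<le> (K + ?H) * step_len (Suc k)"
      by (rule mult_nonneg_nonneg) (use K H step_len_nonneg in auto)
    ultimately show ?thesis
      unfolding eps_kkt_def prod.case adj_mult[symmetric] res_def[symmetric] V_residual_zero norm_zero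
      using le[of k] norm_res_le[of k] by linarith
  qed
  then show ?thesis using K H by (intro exI[of _ "K + ?H"]) auto
qed

lemma gradient_lagrangian_le:
  "\<exists>K\<ge>0. \<forall>k. norm (gradient (aug_lagrangian f A b \<gamma> \<rho>)
      (U (Suc (Suc k)), V (Suc (Suc k)), lam (Suc (Suc k)))) \<le> K * step_len (Suc k)"
proof -
  let ?s = "sqrt (\<Sum>i\<in>UNIV. (norm (A i))\<^sup>2)" and ?H = "sqrt (\<rho> * \<gamma> / 2)"
  have s: "?s \<ge> 0" by (simp add: sum_nonneg)
  have H: "?H \<ge> 0" using rho_pos gamma_pos by simp
  obtain K where K: "K \<ge> 0" and le: "\<And>k. norm (gradient f (U (Suc (Suc k)) ** transpose (V (Suc (Suc k)))) ** V (Suc (Suc k))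
      + \<gamma> *\<^sub>R (U (Suc (Suc k)) - V (Suc (Suc k))) + adj (lam (Suc (Suc k))) ** V (Suc (Suc k)))
    \<le> K * step_len (Suc k)"
    using U_residual_le by blast
  show ?thesis
  proof (intro exI[of _ "(K + ?s * ?H * \<delta>) + (?s * ?H * \<delta> + ?H / \<rho>)"] conjI allI)
    show "0 \<le> (K + ?s * ?H * \<delta>) + (?s * ?H * \<delta> + ?H / \<rho>)"
      using K s H delta_pos rho_pos by simp
    fix k
    define u v l where "u = U (Suc (Suc k))" and "v = V (Suc (Suc k))" and "l = lam (Suc (Suc k))"
    have G: "norm u \<le> \<delta>" "norm v \<le> \<delta>"
      unfolding u_def v_def by (rule norm_le_delta, rule U_in_G V_in_G)+
    have "\<rho> *\<^sub>R res u v = lam (Suc (Suc k)) - lam (Suc k)"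
      by (simp add: u_def v_def lam_step[of "Suc k"])
    then have "norm (adj (\<rho> *\<^sub>R res u v)) \<le> ?s * (?H * step_len (Suc k))"
      by (simp only:) (intro order_trans[OF norm_adj_le] mult_left_mono norm_lam_step_le s)
    then have adj_le: "norm (adj (\<rho> *\<^sub>R res u v) ** w) \<le> ?s * (?H * step_len (Suc k)) * \<delta>"
      if "norm w \<le> \<delta>" for w :: "real^'r^'n"
      using that s H delta_pos step_len_nonneg
      by (intro order_trans[OF norm_matrix_mult_le] mult_mono) auto
    let ?P = "gradient f (u ** transpose v) ** v + \<gamma> *\<^sub>R (u - v) + adj (l + \<rho> *\<^sub>R res u v) ** v"
    let ?Q = "gradient f (v ** transpose u) ** u + \<gamma> *\<^sub>R (v - u) + adj (l + \<rho> *\<^sub>R res u v) ** u"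
    have "norm ?P \<le> K * step_len (Suc k) + ?s * (?H * step_len (Suc k)) * \<delta>"
      unfolding adj_add matrix_mult_add_left add.assoc[symmetric]
      by (rule norm_triangle_le, rule add_mono[OF _ adj_le[OF G(2)]])
        (use le[of k] in \<open>simp add: u_def v_def l_def\<close>)
    moreover have "norm ?Q \<le> ?s * (?H * step_len (Suc k)) * \<delta>"
      unfolding adj_add matrix_mult_add_left add.assoc[symmetric]
      using V_residual_zero[of "Suc k"] adj_le[OF G(1)] by (simp add: u_def v_def l_def)
    moreover have "norm (res u v) \<le> ?H / \<rho> * step_len (Suc k)"
      unfolding u_def v_def by (rule norm_res_le)
    ultimately have "norm (?P, ?Q, res u v)
        \<le> (K * step_len (Suc k) + ?s * (?H * step_len (Suc k)) * \<delta>)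
          + (?s * (?H * step_len (Suc k)) * \<delta> + ?H / \<rho> * step_len (Suc k))"
      by (intro order_trans[OF norm_Pair_le] add_mono)
    then show "norm (gradient (aug_lagrangian f A b \<gamma> \<rho>)
        (U (Suc (Suc k)), V (Suc (Suc k)), lam (Suc (Suc k))))
      \<le> ((K + ?s * ?H * \<delta>) + (?s * ?H * \<delta> + ?H / \<rho>)) * step_len (Suc k)"
      unfolding u_def[symmetric] v_def[symmetric] l_def[symmetric]
        gradient_eq[OF GDERIV_aug_lagrangian] by (simp add: algebra_simps)
  qed
qed

lemma continuous_on_aug_lagrangian:
  "continuous_on UNIV (aug_lagrangian f A b \<gamma> \<rho> :: (real^'r^'n) \<times> (real^'r^'n) \<times> (real^'m) \<Rightarrow> real)"
proof -
  have "aug_lagrangian f A b \<gamma> \<rho> = (\<lambda>z::(real^'r^'n) \<times> (real^'r^'n) \<times> (real^'m).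
      AL (fst z) (fst (snd z)) (snd (snd z)))"
    by (auto simp: fun_eq_iff aug_lagrangian_eq_AL)
  then show ?thesis by (simp only: AL_def) (intro continuous_intros)
qed

lemma continuous_on_adj [continuous_intros]:
  "continuous_on S g \<Longrightarrow> continuous_on S (\<lambda>x. adj (g x))"
  unfolding adj_def by (intro continuous_intros)

lemma continuous_on_gradient_lagrangian:
  "continuous_on UNIV (gradient (aug_lagrangian f A b \<gamma> \<rho> :: (real^'r^'n) \<times> (real^'r^'n) \<times> (real^'m) \<Rightarrow> real))"
proof -
  have "gradient (aug_lagrangian f A b \<gamma> \<rho>) = (\<lambda>z::(real^'r^'n) \<times> (real^'r^'n) \<times> (real^'m).
    let U = fst z; V = fst (snd z); l = snd (snd z) in
    (gradient f (U ** transpose V) ** V + \<gamma> *\<^sub>R (U - V) + adj (l + \<rho> *\<^sub>R res U V) ** V,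
     gradient f (V ** transpose U) ** U + \<gamma> *\<^sub>R (V - U) + adj (l + \<rho> *\<^sub>R res U V) ** U,
     res U V))"
    by (auto simp: fun_eq_iff Let_def intro: gradient_eq[OF GDERIV_aug_lagrangian])
  then show ?thesis by (simp only: Let_def) (intro continuous_intros)
qed

lemma kkt_if_gradient_zero:
  assumes "gradient (aug_lagrangian f A b \<gamma> \<rho>) Z = 0"
  shows "Z \<in> (kkt_points f A b \<gamma> :: ((real^'r^'n) \<times> (real^'r^'n) \<times> (real^'m)) set)"
proof -
  obtain X Y l where Z: "Z = (X, Y, l)" by (cases Z)
  have "(gradient f (X ** transpose Y) ** Y + \<gamma> *\<^sub>R (X - Y) + adj (l + \<rho> *\<^sub>R res X Y) ** Y,
     gradient f (Y ** transpose X) ** X + \<gamma> *\<^sub>R (Y - X) + adj (l + \<rho> *\<^sub>R res X Y) ** X,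
     res X Y) = 0"
    using assms unfolding Z gradient_eq[OF GDERIV_aug_lagrangian] .
  then show ?thesis
    by (auto simp: Z kkt_points_def eps_kkt_def zero_prod_def res_def simp flip: adj_mult)
qed

text \<open>
  The sequence is shifted by one, because only from the first iteration on is the dual variable a
  multiplier.
\<close>

theorem convergence:
  assumes loj: "lojasiewicz_on (aug_lagrangian f A b \<gamma> \<rho>)
      (kkt_points f A b \<gamma> :: ((real^'r^'n) \<times> (real^'r^'n) \<times> (real^'m)) set) \<alpha>"
    and \<alpha>: "0 \<le> \<alpha>" "\<alpha> < 1"
  shows "summable (\<lambda>k. step_len (Suc k))"
    and "\<exists>Z\<in>kkt_points f A b \<gamma>. (\<lambda>k. (U k, V k, lam k)) \<longlonglongrightarrow> Z"
proof -
  define z where "z k = (U (Suc k), V (Suc k), lam (Suc k))" for k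
  obtain c d where c: "c > 0" "d > 0"
    and KL: "\<And>Z Z'. Z' \<in> kkt_points f A b \<gamma> \<Longrightarrow> dist Z Z' \<le> d \<Longrightarrow>
      \<bar>aug_lagrangian f A b \<gamma> \<rho> Z - aug_lagrangian f A b \<gamma> \<rho> Z'\<bar> powr \<alpha>
        \<le> c * norm (gradient (aug_lagrangian f A b \<gamma> \<rho>) (Z :: (real^'r^'n) \<times> (real^'r^'n) \<times> (real^'m)))"
    using loj unfolding lojasiewicz_on_def by blast
  obtain a where a: "a > 0" and descent: "\<And>k. aug_lagrangian f A b \<gamma> \<rho> (z (Suc k)) + a * (step_len (Suc k))\<^sup>2
      \<le> aug_lagrangian f A b \<gamma> \<rho> (z k)"
    using sufficient_descent unfolding z_def aug_lagrangian_eq_AL by blast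
  obtain K where K: "K \<ge> 0" and grad: "\<And>k. norm (gradient (aug_lagrangian f A b \<gamma> \<rho>) (z (Suc k)))
      \<le> K * step_len (Suc k)"
    using gradient_lagrangian_le unfolding z_def by blast
  let ?C = "1 + sqrt (\<rho> * \<gamma> / 2)"
  have C: "?C \<ge> 0" using rho_pos gamma_pos by simp
  have step: "dist (z (Suc k)) (z k) \<le> ?C * step_len (Suc k)" for k
  proof -
    have "dist (z (Suc k)) (z k) \<le> norm (U (Suc (Suc k)) - U (Suc k))
        + (norm (V (Suc (Suc k)) - V (Suc k)) + norm (lam (Suc (Suc k)) - lam (Suc k)))"
      unfolding z_def dist_norm diff_Pair
      by (intro order_trans[OF norm_Pair_le] add_left_mono norm_Pair_le)
    then show ?thesis
      using norm_lam_step_le[of k] by (simp add: step_len_def algebra_simps)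
  qed
  have "bounded (range z)"
  proof (rule boundedI)
    fix x assume "x \<in> range z"
    then obtain k where x: "x = (U (Suc k), V (Suc k), lam (Suc k))" by (auto simp: z_def)
    show "norm x \<le> \<delta> + (\<delta> + \<Lambda>)"
      unfolding x
      by (intro order_trans[OF norm_Pair_le] add_mono order_trans[OF norm_Pair_le] norm_le_delta
          U_in_G V_in_G norm_lam_le)
  qed
  note conv = lojasiewicz_convergence[OF this continuous_on_aug_lagrangian
      continuous_on_gradient_lagrangian kkt_if_gradient_zero \<alpha> c KL step_len_nonneg a C K descent
      step grad]
  show "summable (\<lambda>k. step_len (Suc k))" by (rule conv(1))
  obtain Z where Z: "Z \<in> kkt_points f A b \<gamma>" "z \<longlonglongrightarrow> Z" using conv(2) by blast
  have "(\<lambda>k. (U k, V k, lam k)) \<longlonglongrightarrow> Z"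
    by (rule LIMSEQ_imp_Suc) (use Z(2) in \<open>simp add: z_def[abs_def]\<close>)
  then show "\<exists>Z\<in>kkt_points f A b \<gamma>. (\<lambda>k. (U k, V k, lam k)) \<longlonglongrightarrow> Z" using Z(1) by blast
qed

lemma eps_kkt_mono: "eps_kkt f A b \<gamma> \<epsilon> Z \<Longrightarrow> \<epsilon> \<le> \<epsilon>' \<Longrightarrow> eps_kkt f A b \<gamma> \<epsilon>' Z"
  unfolding eps_kkt_def by (auto split: prod.splits intro: order_trans)

text \<open>
  Among the first \<open>n\<close> steps one has length at most \<open>S/n\<close>, and the KKT residuals are bounded by a
  multiple of the step length; \<open>n\<close> is chosen of order \<open>1/\<epsilon>\<close>.
\<close>

theorem iteration_complexity:
  assumes "summable (\<lambda>k. step_len (Suc k))"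
  shows "\<exists>M>0. \<exists>\<epsilon>\<^sub>0>0. \<forall>\<epsilon>. 0 < \<epsilon> \<and> \<epsilon> \<le> \<epsilon>\<^sub>0 \<longrightarrow>
    (\<exists>k. real k \<le> M / \<epsilon> \<and> eps_kkt f A b \<gamma> \<epsilon> (U k, V k, lam k))"
proof -
  obtain K where K: "K \<ge> 0" and kkt: "\<And>k. eps_kkt f A b \<gamma> (K * step_len (Suc k))
      (U (Suc (Suc k)), V (Suc (Suc k)), lam (Suc (Suc k)))"
    using eps_kkt_le by blast
  obtain S where S: "S \<ge> 0" and small: "\<And>n::nat. n > 0 \<Longrightarrow> \<exists>k<n. step_len (Suc k) \<le> S / real n"
    using summable_imp_small_term[OF assms step_len_nonneg] by blast
  have "\<exists>k. real k \<le> (K * S + 3) / \<epsilon> \<and> eps_kkt f A b \<gamma> \<epsilon> (U k, V k, lam k)"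
    if \<epsilon>: "0 < \<epsilon>" "\<epsilon> \<le> 1" for \<epsilon>
  proof -
    define n where "n = Suc (nat \<lceil>K * S / \<epsilon>\<rceil>)"
    have KS: "0 \<le> K * S / \<epsilon>" using K S \<epsilon> by simp
    then have n: "K * S / \<epsilon> \<le> real n" "real n \<le> K * S / \<epsilon> + 2"
      unfolding n_def by linarith+
    obtain k where k: "k < n" "step_len (Suc k) \<le> S / real n"
      using small[of n] by (auto simp: n_def)
    have "K * step_len (Suc k) \<le> K * (S / real n)" using k(2) K by (rule mult_left_mono)
    also have "\<dots> \<le> \<epsilon>" using n(1) \<epsilon> by (simp add: n_def field_simps)
    finally have "eps_kkt f A b \<gamma> \<epsilon> (U (Suc (Suc k)), V (Suc (Suc k)), lam (Suc (Suc k)))"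
      by (rule eps_kkt_mono[OF kkt])
    moreover have "real (Suc (Suc k)) \<le> (K * S + 3) / \<epsilon>"
    proof -
      have "real (Suc (Suc k)) \<le> K * S / \<epsilon> + 3" using k(1) n(2) by linarith
      also have "3 \<le> 3 / \<epsilon>" using \<epsilon> by (simp add: field_simps)
      finally show ?thesis by (simp add: add_divide_distrib)
    qed
    ultimately show ?thesis by blast
  qed
  moreover have "0 < K * S + 3" using mult_nonneg_nonneg[OF K S] by linarith
  ultimately show ?thesis by (metis zero_less_one)
qed

end

section \<open>From the level set hypotheses to the iteration\<close>

lemma norm_vec_mat: "norm (vec_mat X) = norm X"
  for X :: "real^'r^'n"
proof -
  have "(norm (vec_mat X))\<^sup>2 = (\<Sum>p\<in>UNIV \<times> UNIV. (X $ snd p $ fst p)\<^sup>2)"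
    by (simp add: power2_norm_vec vec_mat_def)
  also have "\<dots> = (\<Sum>j\<in>UNIV. \<Sum>i\<in>UNIV. (X $ i $ j)\<^sup>2)"
    by (simp add: sum.cartesian_product case_prod_beta)
  also have "\<dots> = (\<Sum>i\<in>UNIV. \<Sum>j\<in>UNIV. (X $ i $ j)\<^sup>2)"
    by (rule sum.swap)
  also have "\<dots> = (norm X)\<^sup>2"
    by (simp add: power2_norm_vec)
  finally show ?thesis by (simp add: power2_eq_iff_nonneg)
qed

lemma norm_constr_mat_mult:
  "norm (constr_mat A U *v x) = norm (\<Sum>i\<in>UNIV. x $ i *\<^sub>R (A i ** U))"
  for A :: "'m::finite \<Rightarrow> real^'n^'n" and U :: "real^'r^'n"
proof -
  have "constr_mat A U *v x = vec_mat (\<Sum>i\<in>UNIV. x $ i *\<^sub>R (A i ** U))"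
    by (simp add: constr_mat_def vec_mat_def matrix_vector_mult_def vec_eq_iff mult.commute)
  then show ?thesis by (simp add: norm_vec_mat)
qed

lemma sigma_min_mult_norm_le: "sigma_min M * norm x \<le> norm (M *v x)"
  for M :: "real^'m^'k"
proof (cases "x = 0")
  case False
  have "sigma_min M \<le> norm (M *v ((1 / norm x) *\<^sub>R x))"
    unfolding sigma_min_def
    by (rule cINF_lower) (use False in \<open>auto intro!: bdd_belowI[of _ 0]\<close>)
  also have "\<dots> = norm (M *v x) / norm x"
    by (simp add: matrix_vector_mult_scaleR)
  finally show ?thesis using False by (simp add: field_simps)
qed simp

theorem theorem2:
  fixes f :: "real^'n^'n \<Rightarrow> real"
    and A :: "'m::finite \<Rightarrow> real^'n^'n"
    and b :: "real^'m"
    and \<gamma> \<rho> \<rho>\<^sub>0 \<beta>\<^sub>0 \<beta>hat \<delta> \<eta> \<alpha> Lf L :: real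
    and U V :: "nat \<Rightarrow> real^'r^'n"
    and lam :: "nat \<Rightarrow> real^'m"
  assumes "convex_on UNIV f" and "twice_differentiable f"
    and "\<And>i. transpose (A i) = A i"
    and "\<gamma> > 0" and "\<rho> > 0"
    and A1_kkt: "(kkt_points f A b \<gamma> :: ((real^'r^'n) \<times> (real^'r^'n) \<times> (real^'m)) set) \<noteq> {}"
    and A1_sym: "\<And>X. f X = f (transpose X)"
    and A1_grad: "\<And>K. convex K \<Longrightarrow> compact K \<Longrightarrow> \<exists>M. M-lipschitz_on K (gradient f)"
    and A1_hess: "\<And>K. convex K \<Longrightarrow> compact K \<Longrightarrow> \<exists>M. M-lipschitz_on K (hessian f)"
    and A2: "\<rho>\<^sub>0 > 0"
      "\<And>\<beta>. compact (level_set f A b \<rho>\<^sub>0 \<beta> :: ((real^'r^'n) \<times> (real^'r^'n)) set)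
            \<or> (level_set f A b \<rho>\<^sub>0 \<beta> :: ((real^'r^'n) \<times> (real^'r^'n)) set) = {}"
    and delta: "\<delta> > 0"
      "\<And>X Y :: real^'r^'n. (X, Y) \<in> level_set f A b \<rho>\<^sub>0 \<beta>hat \<Longrightarrow> norm X \<le> \<delta> \<and> norm Y \<le> \<delta>"
    and A3: "\<eta> > 0"
      "\<And>X Y :: real^'r^'n. (X, Y) \<in> level_set f A b \<rho>\<^sub>0 \<beta>hat \<Longrightarrow> sigma_min (constr_mat A X) \<ge> \<eta>"
    and A4: "0 \<le> \<alpha>" "\<alpha> < 1"
      "lojasiewicz_on (aug_lagrangian f A b \<gamma> \<rho>)
         (kkt_points f A b \<gamma> :: ((real^'r^'n) \<times> (real^'r^'n) \<times> (real^'m)) set) \<alpha>"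
    and Lf: "\<And>X. norm X \<le> \<delta>\<^sup>2 \<Longrightarrow> norm (gradient f X) \<le> Lf"
    and L: "L-lipschitz_on (cball 0 (\<delta>\<^sup>2)) (gradient f)"
    and init: "aug_lagrangian f A b \<gamma> \<rho> (U 0, V 0, lam 0) + 1 / \<rho> * (norm (lam 0))\<^sup>2 \<le> \<beta>\<^sub>0"
      "\<beta>\<^sub>0 < \<beta>hat"
    and rho: "\<rho> > Max {2 * \<rho>\<^sub>0,
                2 * const_c1 \<eta> \<delta> L Lf \<gamma> (\<Sum>i\<in>UNIV. (norm (A i))\<^sup>2) / \<gamma>,
                2 * const_c2 \<eta> \<delta> L \<gamma> / \<gamma>,
                1 / (\<beta>hat - \<beta>\<^sub>0) * ((Lf * \<delta> + 2 * \<gamma> * \<delta>) / \<eta>)\<^sup>2}"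
    and "\<gamma> > \<rho>\<^sub>0"
    and "admm f A b \<gamma> \<rho> U V lam"
  shows "(\<exists>Z \<in> kkt_points f A b \<gamma>. (\<lambda>k. (U k, V k, lam k)) \<longlonglongrightarrow> Z) \<and>
         (\<exists>M>0. \<exists>\<epsilon>\<^sub>0>0. \<forall>\<epsilon>. 0 < \<epsilon> \<and> \<epsilon> \<le> \<epsilon>\<^sub>0 \<longrightarrow>
            (\<exists>k. real k \<le> M / \<epsilon> \<and> eps_kkt f A b \<gamma> \<epsilon> (U k, V k, lam k)))"
proof -
  have rho_bounds: "\<rho> > 2 * \<rho>\<^sub>0"
    "\<rho> > 2 * const_c1 \<eta> \<delta> L Lf \<gamma> (\<Sum>i\<in>UNIV. (norm (A i))\<^sup>2) / \<gamma>"
    "\<rho> > 2 * const_c2 \<eta> \<delta> L \<gamma> / \<gamma>"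
    "\<rho> > 1 / (\<beta>hat - \<beta>\<^sub>0) * ((Lf * \<delta> + 2 * \<gamma> * \<delta>) / \<eta>)\<^sup>2"
    using rho by simp_all
  interpret penalized_problem f A b \<gamma> \<rho>
  proof
    show "f differentiable (at X)" for X
      using assms(2) by (simp add: twice_differentiable_def)
    show "continuous_on UNIV (gradient f)"
      using assms(2)
      by (simp add: twice_differentiable_def continuous_on_eq_continuous_within
          differentiable_imp_continuous_within)
  qed (use assms(1,3-5) A1_sym in simp_all)
  have level: "(X, Y) \<in> level_set f A b \<rho>\<^sub>0 \<beta>" if "T X Y \<le> \<beta>" for X Y :: "real^'r^'n" and \<beta>
  proof -
    have "\<rho>\<^sub>0 / 2 * (norm (X - Y))\<^sup>2 \<le> \<gamma> / 2 * (norm (X - Y))\<^sup>2"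
      "\<rho>\<^sub>0 / 2 * (norm (res X Y))\<^sup>2 \<le> \<rho> / 4 * (norm (res X Y))\<^sup>2"
      by (rule mult_right_mono; use \<open>\<gamma> > \<rho>\<^sub>0\<close> rho_bounds(1) in simp)+
    then show ?thesis
      using that unfolding level_set_def T_def D_def res_def by simp
  qed
  have closed_T: "closed {(X :: real^'r^'n, Y). T X Y \<le> \<beta>}" for \<beta>
    unfolding case_prod_beta by (intro closed_Collect_le continuous_intros)
  \<comment> \<open>The factors that have a partner at level \<open>\<beta>hat\<close>; a partner may differ from the ADMM iterate.\<close>
  define G :: "(real^'r^'n) set" where "G = {X. \<exists>Y. T X Y \<le> \<beta>hat}"
  interpret regular_problem f A b \<gamma> \<rho> G \<delta> \<eta> Lf L \<beta>hat
  proof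
    show "L \<ge> 0" using L by (rule lipschitz_on_nonneg)
    show "norm X \<le> \<delta>" if "X \<in> G" for X
      using that delta(2) level unfolding G_def by blast
    show "\<eta> * norm y \<le> norm (adj y ** X)" if "X \<in> G" for X y
    proof -
      have "\<eta> \<le> sigma_min (constr_mat A X)" using that A3(2) level unfolding G_def by blast
      then have "\<eta> * norm y \<le> sigma_min (constr_mat A X) * norm y" by (rule mult_right_mono) simp
      then show ?thesis
        using sigma_min_mult_norm_le[of "constr_mat A X" y] by (simp add: norm_constr_mat_mult adj_mult)
    qed
    show "compact {(X :: real^'r^'n, Y). T X Y \<le> \<beta>}" for \<beta>
    proof -
      have "compact (level_set f A b \<rho>\<^sub>0 \<beta> :: ((real^'r^'n) \<times> (real^'r^'n)) set)"
        using A2(2)[of \<beta>] by auto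
      then have "compact (level_set f A b \<rho>\<^sub>0 \<beta> \<inter> {(X :: real^'r^'n, Y). T X Y \<le> \<beta>})"
        using closed_T by (rule compact_Int_closed)
      moreover have "level_set f A b \<rho>\<^sub>0 \<beta> \<inter> {(X :: real^'r^'n, Y). T X Y \<le> \<beta>}
          = {(X, Y). T X Y \<le> \<beta>}" using level by auto
      ultimately show ?thesis by simp
    qed
    show "norm (gradient f X - gradient f Y) \<le> L * norm (X - Y)"
      if "norm X \<le> \<delta>\<^sup>2" "norm Y \<le> \<delta>\<^sup>2" for X Y
      using lipschitz_onD[OF L, of X Y] that by (simp add: dist_norm)
    show "const_c1 \<eta> \<delta> L Lf \<gamma> (\<Sum>i\<in>UNIV. (norm (A i))\<^sup>2) < \<rho> * \<gamma> / 2"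
      using rho_bounds(2) \<open>\<gamma> > 0\<close> by (simp add: field_simps)
    show "const_c2 \<eta> \<delta> L \<gamma> < \<rho> * \<gamma> / 2"
      using rho_bounds(3) \<open>\<gamma> > 0\<close> by (simp add: field_simps)
  qed (use delta(1) A3(1) Lf in \<open>auto simp: G_def\<close>)
  interpret admm_run f A b \<gamma> \<rho> G \<delta> \<eta> Lf L \<beta>hat U V lam \<beta>\<^sub>0
  proof
    show "AL (U 0) (V 0) (lam 0) + (norm (lam 0))\<^sup>2 / \<rho> \<le> \<beta>\<^sub>0"
      using init(1) by (simp add: aug_lagrangian_eq_AL)
    show "\<beta>\<^sub>0 + \<Lambda>\<^sup>2 / \<rho> < \<beta>hat"
    proof -
      have "\<Lambda>\<^sup>2 / (\<beta>hat - \<beta>\<^sub>0) < \<rho>" using rho_bounds(4) by (simp add: \<Lambda>_def)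
      then have "\<Lambda>\<^sup>2 < \<rho> * (\<beta>hat - \<beta>\<^sub>0)" using init(2) by (simp add: pos_divide_less_eq)
      then have "\<Lambda>\<^sup>2 / \<rho> < \<beta>hat - \<beta>\<^sub>0" using \<open>\<rho> > 0\<close> by (simp add: pos_divide_less_eq mult.commute)
      then show ?thesis by simp
    qed
  qed (use \<open>admm f A b \<gamma> \<rho> U V lam\<close> in
      \<open>auto simp: admm_def is_arg_min_def aug_lagrangian_eq_AL res_def not_less\<close>)
  show ?thesis
    using convergence[OF A4(3,1,2)] iteration_complexity by blast
qed

end
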